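(* Let $\mathcal{M}$ be a saturated model of Presburger arithmetic, $\mathcal{M}_0\preceq\mathcal{M}$ a small elementary submodel, and $\phi(x,a)$ a formula with $a$ a tuple from $\mathcal{M}$ such that $X(a)=\phi(\mathcal{M},a)\subseteq\mathcal{M}^n$ is bounded. Then the following are equivalent: (1) $\phi(x,a)$ does not fork over $\mathcal{M}_0$; (2) the family $\{\phi(\mathcal{M},y): y\models \mathrm{tp}(a/\mathcal{M}_0)\}$ has the finite intersection property; (3) $\phi(\mathcal{M},a)\cap\mathcal{M}_0^n\neq\emptyset$.
   Context: Presburger arithmetic is $\mathrm{Th}(\mathbb{Z},+,-,<,0,1,\{\equiv_n\}_n)$. A definable set $X\subseteq\mathcal{M}^n$ is bounded if there is $0<\alpha\in\mathcal{M}$ with $-\alpha<x_i<\alpha$ for all $x\in X$ and all coordinates $i\le n$. *)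

theory Defs
  imports Main
begin

datatype ptm = PVar nat | PZero | POne | PPlus ptm ptm | PMinus ptm ptm

datatype pfm = PEq ptm ptm | PLess ptm ptm | PCong nat ptm ptm
  | PFalse | PNot pfm | PAnd pfm pfm | PEx nat pfm

fun tvars :: "ptm \<Rightarrow> nat set" where
  "tvars (PVar i) = {i}"
| "tvars PZero = {}"
| "tvars POne = {}"
| "tvars (PPlus s t) = tvars s \<union> tvars t"
| "tvars (PMinus s t) = tvars s \<union> tvars t"

fun fv :: "pfm \<Rightarrow> nat set" where
  "fv (PEq s t) = tvars s \<union> tvars t"
| "fv (PLess s t) = tvars s \<union> tvars t"
| "fv (PCong k s t) = tvars s \<union> tvars t"
| "fv PFalse = {}"
| "fv (PNot f) = fv f"
| "fv (PAnd f g) = fv f \<union> fv g"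
| "fv (PEx k f) = fv f - {k}"

record 'm pstruct =
  pzero :: 'm
  pone :: 'm
  pplus :: "'m \<Rightarrow> 'm \<Rightarrow> 'm"
  pminus :: "'m \<Rightarrow> 'm \<Rightarrow> 'm"
  pless :: "'m \<Rightarrow> 'm \<Rightarrow> bool"
  pcong :: "nat \<Rightarrow> 'm \<Rightarrow> 'm \<Rightarrow> bool"

fun teval :: "'m pstruct \<Rightarrow> ptm \<Rightarrow> (nat \<Rightarrow> 'm) \<Rightarrow> 'm" where
  "teval M (PVar i) v = v i"
| "teval M PZero v = pzero M"
| "teval M POne v = pone M"
| "teval M (PPlus s t) v = pplus M (teval M s v) (teval M t v)"
| "teval M (PMinus s t) v = pminus M (teval M s v) (teval M t v)"

text \<open>Satisfaction, with quantifiers relativised to a domain D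
  (D = UNIV: satisfaction in M; D = a subset: satisfaction in the substructure).\<close>
fun psat :: "'m set \<Rightarrow> 'm pstruct \<Rightarrow> pfm \<Rightarrow> (nat \<Rightarrow> 'm) \<Rightarrow> bool" where
  "psat D M (PEq s t) v = (teval M s v = teval M t v)"
| "psat D M (PLess s t) v = pless M (teval M s v) (teval M t v)"
| "psat D M (PCong k s t) v = pcong M k (teval M s v) (teval M t v)"
| "psat D M PFalse v = False"
| "psat D M (PNot f) v = (\<not> psat D M f v)"
| "psat D M (PAnd f g) v = (psat D M f v \<and> psat D M g v)"
| "psat D M (PEx k f) v = (\<exists>d\<in>D. psat D M f (v(k := d)))"

definition Zstr :: "int pstruct" where
  "Zstr = \<lparr>pzero = 0, pone = 1, pplus = (+), pminus = (-), pless = (<),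
           pcong = (\<lambda>k x y. x mod int k = y mod int k)\<rparr>"

definition models_Pres :: "'m pstruct \<Rightarrow> bool" where
  "models_Pres M \<longleftrightarrow> (\<forall>\<phi>. fv \<phi> = {} \<longrightarrow> (\<forall>v. psat UNIV Zstr \<phi> v) \<longrightarrow> (\<forall>v. psat UNIV M \<phi> v))"

text \<open>Saturation: every finitely satisfiable 1-type (in variable 0) over a parameter set A
  with |A| < |M| is realised. A formula with parameters is a pair (formula, assignment into A).\<close>
definition saturated :: "'m pstruct \<Rightarrow> bool" where
  "saturated M \<longleftrightarrow>
    (\<forall>A \<Sigma>. (card_of A, card_of (UNIV :: 'm set)) \<in> ordLess \<longrightarrow>
       (\<forall>(\<psi>, w) \<in> \<Sigma>. range w \<subseteq> A) \<longrightarrow>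
       (\<forall>F. finite F \<longrightarrow> F \<subseteq> \<Sigma> \<longrightarrow> (\<exists>b. \<forall>(\<psi>, w) \<in> F. psat UNIV M \<psi> (w(0 := b)))) \<longrightarrow>
       (\<exists>b. \<forall>(\<psi>, w) \<in> \<Sigma>. psat UNIV M \<psi> (w(0 := b))))"

definition elem_sub :: "'m set \<Rightarrow> 'm pstruct \<Rightarrow> bool" where
  "elem_sub S M \<longleftrightarrow> S \<noteq> {} \<and> pzero M \<in> S \<and> pone M \<in> S \<and>
     (\<forall>x\<in>S. \<forall>y\<in>S. pplus M x y \<in> S \<and> pminus M x y \<in> S) \<and>
     (\<forall>\<phi> v. range v \<subseteq> S \<longrightarrow> (psat S M \<phi> v \<longleftrightarrow> psat UNIV M \<phi> v))"

definition asg :: "nat \<Rightarrow> 'm list \<Rightarrow> 'm list \<Rightarrow> nat \<Rightarrow> 'm" where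
  "asg n x a = (\<lambda>i. if i < n then x ! i else a ! (i - n))"

definition defset :: "'m pstruct \<Rightarrow> pfm \<Rightarrow> nat \<Rightarrow> 'm list \<Rightarrow> 'm list set" where
  "defset M \<phi> n a = {x. length x = n \<and> psat UNIV M \<phi> (asg n x a)}"

definition bounded_pres :: "'m pstruct \<Rightarrow> nat \<Rightarrow> 'm list set \<Rightarrow> bool" where
  "bounded_pres M n X \<longleftrightarrow> (\<exists>\<alpha>. pless M (pzero M) \<alpha> \<and>
     (\<forall>x\<in>X. \<forall>i<n. pless M (pminus M (pzero M) \<alpha>) (x ! i) \<and> pless M (x ! i) \<alpha>))"

text \<open>Types over S: b realises tp(a/S). Formulas \<psi> with even variables 2i standing for a_i
  and odd variables 2i+1 standing for parameters from S.\<close>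
definition merge :: "'m list \<Rightarrow> (nat \<Rightarrow> 'm) \<Rightarrow> nat \<Rightarrow> 'm" where
  "merge a c = (\<lambda>i. if even i then a ! (i div 2) else c (i div 2))"

definition same_type :: "'m pstruct \<Rightarrow> 'm set \<Rightarrow> 'm list \<Rightarrow> 'm list \<Rightarrow> bool" where
  "same_type M S a b \<longleftrightarrow> length a = length b \<and>
     (\<forall>\<psi> c. range c \<subseteq> S \<longrightarrow> fv \<psi> \<subseteq> {i. odd i \<or> i div 2 < length a} \<longrightarrow>
        (psat UNIV M \<psi> (merge a c) \<longleftrightarrow> psat UNIV M \<psi> (merge b c)))"

definition divides :: "'m pstruct \<Rightarrow> 'm set \<Rightarrow> nat \<Rightarrow> pfm \<Rightarrow> 'm list \<Rightarrow> bool" where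
  "divides M S n \<psi> b \<longleftrightarrow> (\<exists>(c :: nat \<Rightarrow> 'm list) k. k \<ge> 1 \<and> (\<forall>i. same_type M S b (c i)) \<and>
     (\<forall>I. finite I \<longrightarrow> card I = k \<longrightarrow>
        \<not> (\<exists>x. length x = n \<and> (\<forall>i\<in>I. psat UNIV M \<psi> (asg n x (c i))))))"

definition forks :: "'m pstruct \<Rightarrow> 'm set \<Rightarrow> nat \<Rightarrow> pfm \<Rightarrow> 'm list \<Rightarrow> bool" where
  "forks M S n \<phi> a \<longleftrightarrow> (\<exists>\<Psi> :: (pfm \<times> 'm list) list.
     (\<forall>(\<psi>, b) \<in> set \<Psi>. fv \<psi> \<subseteq> {..<n + length b} \<and> divides M S n \<psi> b) \<and>
     defset M \<phi> n a \<subseteq> (\<Union>(\<psi>, b) \<in> set \<Psi>. defset M \<psi> n b))"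

definition fip_type :: "'m pstruct \<Rightarrow> 'm set \<Rightarrow> nat \<Rightarrow> pfm \<Rightarrow> 'm list \<Rightarrow> bool" where
  "fip_type M S n \<phi> a \<longleftrightarrow> (\<forall>F. finite F \<longrightarrow> F \<subseteq> {y. same_type M S a y} \<longrightarrow>
     (\<exists>x. length x = n \<and> (\<forall>y\<in>F. psat UNIV M \<phi> (asg n x y))))"

end

(*
  By quantifier elimination, for fixed a the set X(a) is a finite union of cells, each given by
  linear inequalities L x <= t and by a condition on x over M0. The basic dividing sets are the
  strips l <= L x <= u with no point of M0 in [l, u]: a set definable over M0 which contains l
  cannot be bounded by u, since its maximum would lie in M0, so the strip has infinitely many
  pairwise disjoint conjugates.
  If a cell has no point in M0, saturation gives elements t' in the same cuts of M0 as the bounds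
  t for which the inequalities L x < t' are inconsistent, so the cell is covered by the strips
  t' <= L x <= t; boundedness serves when some t lies below all of M0, where no such t' need exist.
  So if X(a) has no point in M0, finitely many strips cover it and phi(x, a) forks. Replacing X(a)
  by its intersection with suitable conjugates removes the strips one at a time, so the finite
  intersection property fails as well.
*)
theory Submission
  imports Defs
begin

text \<open>Quantifier elimination is carried out only in the integers, on predicates of assignments
  rather than on syntax; a model need only satisfy the one resulting equivalence between a formula
  and its list of cells. In a cell the variables are separated: a congruence mixing x and a splits
  into finitely many cases by residues, so the parameters affect x through the bounds of
  inequalities alone.

  Saturation is available for 1-types only, so conjugation uses partial elementary maps over M0,
  extended one element at a time to the finitely many tuple entries and strip ends at hand, instead
  of automorphisms. That a definable set is covered by given strips is first-order, hence preserved
  by such maps. Merging a strip with its image yields a strip again, so the family of conjugates may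
  double while the number of strips drops.

  Conversely, a point of M0 in X(a) lies in every conjugate of X(a), and likewise in every conjugate
  of a dividing set that contains it, so it gives both other conditions at once.\<close>

section \<open>Dependence on free variables, and renaming\<close>

lemma teval_cong: "(\<And>i. i \<in> tvars t \<Longrightarrow> v i = w i) \<Longrightarrow> teval M t v = teval M t w"
  by (induction t) auto

lemma psat_cong: "(\<And>i. i \<in> fv \<phi> \<Longrightarrow> v i = w i) \<Longrightarrow> psat D M \<phi> v = psat D M \<phi> w"
proof (induction \<phi> arbitrary: v w)
  case (PEx k f)
  have "psat D M f (v(k := d)) = psat D M f (w(k := d))" for d
    by (rule PEx.IH) (use PEx.prems in auto)
  then show ?case by simp
next
  case (PAnd f g)
  have "psat D M f v = psat D M f w"
    by (rule PAnd.IH(1)) (simp add: PAnd.prems)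
  moreover have "psat D M g v = psat D M g w"
    by (rule PAnd.IH(2)) (simp add: PAnd.prems)
  ultimately show ?case by simp
next
  case (PNot f)
  have "psat D M f v = psat D M f w"
    by (rule PNot.IH) (simp add: PNot.prems)
  then show ?case by simp
next
  case (PEq s t)
  then show ?case using teval_cong[of s v w M] teval_cong[of t v w M] by simp
next
  case (PLess s t)
  then show ?case using teval_cong[of s v w M] teval_cong[of t v w M] by simp
next
  case (PCong k s t)
  then show ?case using teval_cong[of s v w M] teval_cong[of t v w M] by simp
qed simp

lemma finite_tvars: "finite (tvars t)"
  by (induction t) auto

lemma finite_fv: "finite (fv \<phi>)"
  by (induction \<phi>) (auto simp: finite_tvars)

fun tren :: "(nat \<Rightarrow> nat) \<Rightarrow> ptm \<Rightarrow> ptm" where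
  "tren \<rho> (PVar i) = PVar (\<rho> i)"
| "tren \<rho> PZero = PZero"
| "tren \<rho> POne = POne"
| "tren \<rho> (PPlus s t) = PPlus (tren \<rho> s) (tren \<rho> t)"
| "tren \<rho> (PMinus s t) = PMinus (tren \<rho> s) (tren \<rho> t)"

lemma teval_tren: "teval M (tren \<rho> t) v = teval M t (v \<circ> \<rho>)"
  by (induction t) auto

lemma tvars_tren: "tvars (tren \<rho> t) = \<rho> ` tvars t"
  by (induction t) auto

text \<open>\<open>\<rho>\<close> need not be injective; a bound variable is sent to some
  \<open>z\<close> outside the image of the free variables, which prevents capture. Only the
  semantic effect is recorded, since bound names change.\<close>

lemma rename_fm:
  "\<exists>\<phi>'. fv \<phi>' \<subseteq> \<rho> ` fv \<phi> \<and> (\<forall>v. psat D M \<phi>' v = psat D M \<phi> (v \<circ> \<rho>))"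
proof (induction \<phi> arbitrary: \<rho>)
  case (PEq s t)
  show ?case by (rule exI[of _ "PEq (tren \<rho> s) (tren \<rho> t)"]) (simp add: teval_tren tvars_tren image_Un o_def)
next
  case (PLess s t)
  show ?case by (rule exI[of _ "PLess (tren \<rho> s) (tren \<rho> t)"]) (simp add: teval_tren tvars_tren image_Un o_def)
next
  case (PCong k s t)
  show ?case by (rule exI[of _ "PCong k (tren \<rho> s) (tren \<rho> t)"]) (simp add: teval_tren tvars_tren image_Un o_def)
next
  case PFalse
  show ?case by (rule exI[of _ PFalse]) auto
next
  case (PNot f)
  obtain f' where "fv f' \<subseteq> \<rho> ` fv f" "\<forall>v. psat D M f' v = psat D M f (v \<circ> \<rho>)"
    using PNot by blast
  then show ?case by (intro exI[of _ "PNot f'"]) (auto simp: o_def)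
next
  case (PAnd f g)
  obtain f' where "fv f' \<subseteq> \<rho> ` fv f" "\<forall>v. psat D M f' v = psat D M f (v \<circ> \<rho>)"
    using PAnd by blast
  moreover obtain g' where "fv g' \<subseteq> \<rho> ` fv g" "\<forall>v. psat D M g' v = psat D M g (v \<circ> \<rho>)"
    using PAnd by blast
  ultimately show ?case by (intro exI[of _ "PAnd f' g'"]) (auto simp: o_def)
next
  case (PEx k f)
  obtain z where z: "z \<notin> \<rho> ` fv f"
    using finite_fv infinite_UNIV_nat by (metis ex_new_if_finite finite_imageI)
  obtain f' where f': "fv f' \<subseteq> \<rho>(k := z) ` fv f"
    "\<forall>v. psat D M f' v = psat D M f (v \<circ> \<rho>(k := z))"
    using PEx by blast
  have "psat D M f (v(z := d) \<circ> \<rho>(k := z)) = psat D M f ((v \<circ> \<rho>)(k := d))" for v d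
    by (rule psat_cong) (use z in auto)
  moreover have "fv f' - {z} \<subseteq> \<rho> ` (fv f - {k})"
    using f'(1) by auto
  ultimately show ?case
    by (intro exI[of _ "PEx z f'"] conjI allI) (simp_all only: psat.simps fv.simps f'(2))
qed

section \<open>Quantifier elimination over the integers\<close>

lemma Zstr_sel [simp]:
  "pzero Zstr = 0" "pone Zstr = 1" "pplus Zstr = (+)" "pminus Zstr = (-)" "pless Zstr = (<)"
  "pcong Zstr = (\<lambda>k x y. x mod int k = y mod int k)"
  by (simp_all add: Zstr_def)

text \<open>Affine functions with integer coefficients, taken as functions so that elimination can
  compute with values; a term is recovered only when cells are formed.\<close>

definition lin :: "((nat \<Rightarrow> int) \<Rightarrow> int) \<Rightarrow> bool" where
  "lin g \<longleftrightarrow> (\<exists>t. g = teval Zstr t)"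

lemma lin_teval: "lin (teval Zstr t)"
  by (auto simp: lin_def)

lemma lin_diff: "lin g \<Longrightarrow> lin h \<Longrightarrow> lin (\<lambda>v. g v - h v)"
proof -
  assume "lin g" "lin h"
  then obtain s t where "g = teval Zstr s" "h = teval Zstr t" by (auto simp: lin_def)
  then show ?thesis unfolding lin_def
    by (intro exI[of _ "PMinus s t"]) (auto simp: fun_eq_iff)
qed

lemma lin_add: "lin g \<Longrightarrow> lin h \<Longrightarrow> lin (\<lambda>v. g v + h v)"
proof -
  assume "lin g" "lin h"
  then obtain s t where "g = teval Zstr s" "h = teval Zstr t" by (auto simp: lin_def)
  then show ?thesis unfolding lin_def
    by (intro exI[of _ "PPlus s t"]) (auto simp: fun_eq_iff)
qed

lemma ex_const_term: "\<exists>t. tvars t = {} \<and> (\<forall>v. teval Zstr t v = r)"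
proof (induction r rule: int_induct[of _ 0])
  case base
  show ?case by (rule exI[of _ PZero]) simp
next
  case (step1 i)
  then obtain t where "tvars t = {}" "\<forall>v. teval Zstr t v = i" by blast
  then show ?case by (intro exI[of _ "PPlus t POne"]) simp
next
  case (step2 i)
  then obtain t where "tvars t = {}" "\<forall>v. teval Zstr t v = i" by blast
  then show ?case by (intro exI[of _ "PMinus t POne"]) simp
qed

lemma lin_const: "lin (\<lambda>v. r)"
  using ex_const_term[of r] by (auto simp: lin_def fun_eq_iff)

lemma lin_mult: "lin g \<Longrightarrow> lin (\<lambda>v. c * g v)"
proof (induction c rule: int_induct[of _ 0])
  case base
  show ?case using lin_const[of 0] by simp
next
  case (step1 i)
  then show ?case using lin_add[of "\<lambda>v. i * g v" g] by (simp add: algebra_simps)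
next
  case (step2 i)
  then show ?case using lin_diff[of "\<lambda>v. i * g v" g] by (simp add: algebra_simps)
qed

lemma lin_split:
  assumes "lin g"
  shows "\<exists>c h. lin h \<and> (\<forall>v. g v = c * v k + h v) \<and> (\<forall>v d. h (v(k := d)) = h v)"
proof -
  have "\<exists>c h. lin h \<and> (\<forall>v. teval Zstr t v = c * v k + h v) \<and> (\<forall>v d. h (v(k := d)) = h v)" for t
  proof (induction t)
    case (PVar i)
    show ?case
    proof (cases "i = k")
      case True
      then show ?thesis using lin_const[of 0]
        by (intro exI[of _ 1] exI[of _ "\<lambda>v. 0"]) auto
    next
      case False
      moreover have "teval Zstr (PVar i) = (\<lambda>v. v i)" by auto
      ultimately show ?thesis using lin_teval[of "PVar i"]
        by (intro exI[of _ 0] exI[of _ "\<lambda>v. v i"]) auto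
    qed
  next
    case PZero
    show ?case by (intro exI[of _ 0] exI[of _ "\<lambda>v. 0"]) (simp add: lin_const)
  next
    case POne
    show ?case by (intro exI[of _ 0] exI[of _ "\<lambda>v. 1"]) (simp add: lin_const)
  next
    case (PPlus s t)
    then obtain c h c' h' where
      "lin h" "\<forall>v. teval Zstr s v = c * v k + h v" "\<forall>v d. h (v(k := d)) = h v"
      "lin h'" "\<forall>v. teval Zstr t v = c' * v k + h' v" "\<forall>v d. h' (v(k := d)) = h' v"
      by blast
    note st = this
    show ?case
    proof (intro exI conjI allI)
      show "lin (\<lambda>v. h v + h' v)" by (intro lin_add st)
      show "teval Zstr (PPlus s t) v = (c + c') * v k + (h v + h' v)" for v
        by (simp add: st(2,5) distrib_right)
      show "h (v(k := d)) + h' (v(k := d)) = h v + h' v" for v d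
        using st(3,6) by simp
    qed
  next
    case (PMinus s t)
    then obtain c h c' h' where
      "lin h" "\<forall>v. teval Zstr s v = c * v k + h v" "\<forall>v d. h (v(k := d)) = h v"
      "lin h'" "\<forall>v. teval Zstr t v = c' * v k + h' v" "\<forall>v d. h' (v(k := d)) = h' v"
      by blast
    note st = this
    show ?case
    proof (intro exI conjI allI)
      show "lin (\<lambda>v. h v - h' v)" by (intro lin_diff st)
      show "teval Zstr (PMinus s t) v = (c - c') * v k + (h v - h' v)" for v
        by (simp add: st(2,5) left_diff_distrib)
      show "h (v(k := d)) - h' (v(k := d)) = h v - h' v" for v d
        using st(3,6) by simp
    qed
  qed
  then show ?thesis using assms unfolding lin_def by blast
qed

section \<open>Quantifier-free predicates on integer assignments\<close>

text \<open>Negation and existential quantification are not constructors but closure properties,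
  \<open>pos_not\<close> and \<open>pos_ex\<close>; with them, \<open>pos_psat\<close> is quantifier
  elimination.\<close>

inductive pos :: "((nat \<Rightarrow> int) \<Rightarrow> bool) \<Rightarrow> bool" where
  pos_ge: "lin g \<Longrightarrow> pos (\<lambda>v. 0 \<le> g v)"
| pos_dvd: "lin g \<Longrightarrow> 0 < N \<Longrightarrow> pos (\<lambda>v. N dvd g v)"
| pos_conj: "pos P \<Longrightarrow> pos Q \<Longrightarrow> pos (\<lambda>v. P v \<and> Q v)"
| pos_disj: "pos P \<Longrightarrow> pos Q \<Longrightarrow> pos (\<lambda>v. P v \<or> Q v)"

lemma pos_const: "pos (\<lambda>v. b)"
  using pos_ge[OF lin_const[of 0]] pos_ge[OF lin_const[of "-1"]] by (cases b) auto

lemma pos_Bex: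
  assumes "finite S" "\<And>x. x \<in> S \<Longrightarrow> pos (P x)"
  shows "pos (\<lambda>v. \<exists>x\<in>S. P x v)"
  using assms
proof (induction S)
  case empty
  show ?case using pos_const by simp
next
  case (insert y S)
  then have "pos (\<lambda>v. P y v \<or> (\<exists>x\<in>S. P x v))" by (intro pos_disj) auto
  then show ?case by simp
qed

lemma pos_Ball:
  assumes "finite S" "\<And>x. x \<in> S \<Longrightarrow> pos (P x)"
  shows "pos (\<lambda>v. \<forall>x\<in>S. P x v)"
  using assms
proof (induction S)
  case empty
  show ?case using pos_const by simp
next
  case (insert y S)
  then have "pos (\<lambda>v. P y v \<and> (\<forall>x\<in>S. P x v))" by (intro pos_conj) auto
  then show ?case by simp
qed

text \<open>Discreteness turns a negated inequality into an inequality, and a number not divisible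
  by \<open>N\<close> has one of finitely many nonzero residues, so no negative atoms arise.\<close>

lemma pos_not: "pos P \<Longrightarrow> pos (\<lambda>v. \<not> P v)"
proof (induction rule: pos.induct)
  case (pos_ge g)
  have "pos (\<lambda>v. 0 \<le> - 1 - g v)"
    by (rule pos.pos_ge) (intro lin_diff lin_const pos_ge)
  moreover have "(\<lambda>v. 0 \<le> - 1 - g v) = (\<lambda>v. \<not> 0 \<le> g v)" by auto
  ultimately show ?case by simp
next
  case (pos_dvd g N)
  have "\<not> N dvd g v \<longleftrightarrow> (\<exists>r\<in>{1..<N}. N dvd g v - r)" for v
  proof
    assume "\<not> N dvd g v"
    then have "g v mod N \<noteq> 0" by (simp add: dvd_eq_mod_eq_0)
    moreover have "0 \<le> g v mod N" "g v mod N < N" using pos_dvd by simp_all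
    ultimately show "\<exists>r\<in>{1..<N}. N dvd g v - r"
      by (intro bexI[of _ "g v mod N"] dvd_minus_mod) auto
  next
    assume "\<exists>r\<in>{1..<N}. N dvd g v - r"
    then obtain r where r: "1 \<le> r" "r < N" "N dvd g v - r" by auto
    show "\<not> N dvd g v"
    proof
      assume "N dvd g v"
      then have "N dvd g v - (g v - r)" using r(3) by (rule dvd_diff)
      then have "N dvd r" by simp
      with r show False using zdvd_imp_le[of N r] by simp
    qed
  qed
  moreover have "pos (\<lambda>v. \<exists>r\<in>{1..<N}. N dvd g v - r)"
    by (intro pos_Bex pos.pos_dvd lin_diff lin_const) (use pos_dvd in auto)
  ultimately show ?case by simp
next
  case (pos_conj P Q)
  have "pos (\<lambda>v. \<not> P v \<or> \<not> Q v)" by (rule pos_disj) (rule pos_conj.IH)+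
  then show ?case by simp
next
  case (pos_disj P Q)
  have "pos (\<lambda>v. \<not> P v \<and> \<not> Q v)" by (rule pos_conj) (rule pos_disj.IH)+
  then show ?case by simp
qed

text \<open>In the first case a solution cannot be decreased by the period \<open>D\<close>, so
  \<open>a * d + p\<close> lies in \<open>[0, a * D)\<close> for one of the lower bounds \<open>(a, p)\<close>. Multiplying the other
  constraints by \<open>a\<close> eliminates \<open>d\<close> without first normalising its coefficients.\<close>
lemma cooper:
  fixes I :: "(int \<times> int) set" and J :: "(int \<times> int \<times> int) set"
  assumes "finite I" and D: "D > 0" "\<And>N c h. (N, c, h) \<in> J \<Longrightarrow> N dvd D"
  shows "(\<exists>d. (\<forall>(c, h)\<in>I. 0 \<le> c * d + h) \<and> (\<forall>(N, c, h)\<in>J. N dvd c * d + h)) \<longleftrightarrow>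
    (\<exists>(a, p)\<in>I. a > 0 \<and> (\<exists>r\<in>{0..<a * D}. a dvd r - p \<and>
        (\<forall>(c, h)\<in>I. 0 \<le> c * (r - p) + a * h) \<and> (\<forall>(N, c, h)\<in>J. a * N dvd c * (r - p) + a * h)))
    \<or> ((\<forall>(a, p)\<in>I. a \<le> 0 \<and> (a = 0 \<longrightarrow> 0 \<le> p)) \<and>
        (\<exists>r\<in>{0..<D}. \<forall>(N, c, h)\<in>J. N dvd c * r + h))"
  (is "?L \<longleftrightarrow> ?R1 \<or> ?R2")
proof
  let ?sol = "\<lambda>d. (\<forall>(c, h)\<in>I. 0 \<le> c * d + h) \<and> (\<forall>(N, c, h)\<in>J. N dvd c * d + h)"
  have shift: "N dvd c * (d - D * K) + h" if "(N, c, h) \<in> J" "N dvd c * d + h" for N c h d K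
  proof -
    have "N dvd c * D * K" using D(2)[OF that(1)] by simp
    then have "N dvd (c * d + h) - c * D * K" using that(2) by (metis dvd_diff)
    then show ?thesis by (simp add: algebra_simps)
  qed
  {
    assume ?L
    show "?R1 \<or> ?R2"
    proof (cases "\<exists>(a, p)\<in>I. a > 0")
      case True
      then obtain a0 p0 where a0: "(a0, p0) \<in> I" "a0 > 0" by auto
      \<comment> \<open>As \<open>a0 > 0\<close>, this \<open>d\<close> is the least solution;
        \<open>nat\<close> loses nothing, since \<open>a0 * d + p0\<close> is nonnegative at
        solutions.\<close>
      obtain d where d: "?sol d" and least: "\<And>y. ?sol y \<Longrightarrow> nat (a0 * d + p0) \<le> nat (a0 * y + p0)"
        using ex_has_least_nat[of ?sol _ "\<lambda>d. nat (a0 * d + p0)"] \<open>?L\<close> by blast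
      have "\<not> ?sol (d - D)"
      proof
        assume s: "?sol (d - D)"
        then have "0 \<le> a0 * (d - D) + p0" "0 \<le> a0 * d + p0" using a0 d by auto
        with least[OF s] have "a0 * d + p0 \<le> a0 * (d - D) + p0" by simp
        with a0 D(1) show False by (simp add: algebra_simps mult_le_0_iff)
      qed
      moreover have "\<forall>(N, c, h)\<in>J. N dvd c * (d - D) + h" using d shift[of _ _ _ d 1] by auto
      \<comment> \<open>\<open>d - D\<close> satisfies all divisibilities but is no solution, so
        some inequality fails there; that one is the lower bound \<open>(a, p)\<close>.\<close>
      ultimately obtain a p where ap: "(a, p) \<in> I" "a * (d - D) + p < 0" by auto
      then have ge: "0 \<le> a * d + p" using d by auto
      with ap(2) have "0 < a * D" by (simp add: algebra_simps)
      with D(1) have apos: "a > 0" by (simp add: zero_less_mult_iff)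
      let ?r = "a * d + p"
      have "\<forall>(c, h)\<in>I. 0 \<le> c * (?r - p) + a * h"
      proof clarify
        fix c h assume "(c, h) \<in> I"
        then have "0 \<le> a * (c * d + h)" using d apos by auto
        then show "0 \<le> c * (?r - p) + a * h" by (simp add: algebra_simps)
      qed
      moreover have "\<forall>(N, c, h)\<in>J. a * N dvd c * (?r - p) + a * h"
      proof clarify
        fix N c h assume "(N, c, h) \<in> J"
        then have "a * N dvd a * (c * d + h)" using d by auto
        then show "a * N dvd c * (?r - p) + a * h" by (simp add: algebra_simps)
      qed
      moreover have "?r \<in> {0..<a * D}" using ge ap(2) by (simp add: algebra_simps)
      ultimately have ?R1
        using ap(1) apos by (intro bexI[of _ "(a, p)"]) (auto intro!: bexI[of _ ?r])
      then show ?thesis ..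
    next
      case False
      then have neg: "\<forall>(a, p)\<in>I. a \<le> 0" by force
      obtain d where d: "?sol d" using \<open>?L\<close> by blast
      have "d mod D = d - D * (d div D)" by (simp add: minus_mult_div_eq_mod)
      then have "\<forall>(N, c, h)\<in>J. N dvd c * (d mod D) + h"
        using d shift[of _ _ _ d "d div D"] by auto
      moreover have "d mod D \<in> {0..<D}" using D by auto
      ultimately have ?R2 using neg d by fastforce
      then show ?thesis ..
    qed
  }
  assume "?R1 \<or> ?R2"
  then show ?L
  proof
    assume ?R1
    then obtain a p r where ap: "(a, p) \<in> I" "a > 0" "a dvd r - p"
      "\<forall>(c, h)\<in>I. 0 \<le> c * (r - p) + a * h" "\<forall>(N, c, h)\<in>J. a * N dvd c * (r - p) + a * h"
      by auto
    then obtain d where d: "r - p = a * d" by blast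
    have "?sol d"
    proof (intro conjI ballI; clarify)
      fix c h assume "(c, h) \<in> I"
      then have "0 \<le> c * (a * d) + a * h" using ap(4) d by auto
      then have "0 \<le> a * (c * d + h)" by (simp add: algebra_simps)
      then show "0 \<le> c * d + h" using ap(2) by (simp add: zero_le_mult_iff)
    next
      fix N c h assume "(N, c, h) \<in> J"
      then have "a * N dvd c * (a * d) + a * h" using ap(5) d by auto
      then have "a * N dvd a * (c * d + h)" by (simp add: algebra_simps)
      then show "N dvd c * d + h" using ap(2) by simp
    qed
    then show ?L by blast
  next
    assume ?R2
    then obtain r where neg: "\<forall>(a, p)\<in>I. a \<le> 0 \<and> (a = 0 \<longrightarrow> 0 \<le> p)"
      and r: "r \<in> {0..<D}" "\<forall>(N, c, h)\<in>J. N dvd c * r + h" by blast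
    \<comment> \<open>Without positive coefficients, \<open>r\<close> may be moved down by any
      multiple of \<open>D\<close>. With this \<open>K\<close>, the number \<open>D * K - r\<close>
      is at least the absolute value of every \<open>h\<close>, which suffices for coefficients up
      to \<open>-1\<close>.\<close>
    define K where "K = r + (\<Sum>(c, h)\<in>I. \<bar>h\<bar>)"
    have "?sol (r - D * K)"
    proof (intro conjI ballI; clarify)
      fix c h assume ch: "(c, h) \<in> I"
      have "\<bar>h\<bar> \<le> (\<Sum>(c, h)\<in>I. \<bar>h\<bar>)"
        using member_le_sum[OF ch, of "\<lambda>(c, h). \<bar>h\<bar>"] \<open>finite I\<close> by auto
      then have K: "K \<ge> r + \<bar>h\<bar>" "K \<ge> 0" using r by (auto simp: K_def)
      then have "K \<le> D * K" using D by (simp add: mult_le_cancel_right1)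
      then have "D * K - r \<ge> \<bar>h\<bar>" using K by linarith
      show "0 \<le> c * (r - D * K) + h"
      proof (cases "c = 0")
        case True
        then show ?thesis using neg ch by auto
      next
        case False
        then have "c \<le> -1" using neg ch by force
        then have "(- c) * (D * K - r) \<ge> 1 * (D * K - r)"
          using \<open>D * K - r \<ge> \<bar>h\<bar>\<close> by (intro mult_right_mono) auto
        then show ?thesis using \<open>D * K - r \<ge> \<bar>h\<bar>\<close> by (simp add: algebra_simps)
      qed
    next
      fix N c h assume "(N, c, h) \<in> J"
      then show "N dvd c * (r - D * K) + h" using r shift by blast
    qed
    then show ?L by blast
  qed
qed

section \<open>Elimination of one existential quantifier\<close>

text \<open>The input of \<open>cooper\<close> for the variable \<open>k\<close>: its coefficient
  \<open>c\<close> is split off, and what remains is \<open>h v\<close>, a value fixed while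
  \<open>d\<close> varies.\<close>

definition conjunct :: "nat \<Rightarrow> ((nat \<Rightarrow> int) \<Rightarrow> bool) \<Rightarrow> bool" where
  "conjunct k P \<longleftrightarrow> (\<exists>(I :: (int \<times> ((nat \<Rightarrow> int) \<Rightarrow> int)) set)
     (J :: (int \<times> int \<times> ((nat \<Rightarrow> int) \<Rightarrow> int)) set).
     finite I \<and> finite J \<and> (\<forall>(c, h)\<in>I. lin h) \<and> (\<forall>(N, c, h)\<in>J. lin h \<and> N > 0) \<and>
     (\<forall>v d. P (v(k := d)) \<longleftrightarrow>
        (\<forall>(c, h)\<in>I. 0 \<le> c * d + h v) \<and> (\<forall>(N, c, h)\<in>J. N dvd c * d + h v)))"

lemma conjunct_ge: "lin g \<Longrightarrow> conjunct k (\<lambda>v. 0 \<le> g v)"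
proof -
  assume "lin g"
  then obtain c h where "lin h" "\<forall>v. g v = c * v k + h v" "\<forall>v d. h (v(k := d)) = h v"
    using lin_split by blast
  then show ?thesis unfolding conjunct_def
    by (intro exI[of _ "{(c, h)}"] exI[of _ "{}"]) auto
qed

lemma conjunct_dvd: "lin g \<Longrightarrow> 0 < N \<Longrightarrow> conjunct k (\<lambda>v. N dvd g v)"
proof -
  assume "lin g" "0 < N"
  then obtain c h where "lin h" "\<forall>v. g v = c * v k + h v" "\<forall>v d. h (v(k := d)) = h v"
    using lin_split by blast
  then show ?thesis unfolding conjunct_def using \<open>0 < N\<close>
    by (intro exI[of _ "{}"] exI[of _ "{(N, c, h)}"]) auto
qed

lemma conjunct_conj:
  assumes "conjunct k P" "conjunct k Q"
  shows "conjunct k (\<lambda>v. P v \<and> Q v)"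
proof -
  from assms(1) obtain I :: "(int \<times> ((nat \<Rightarrow> int) \<Rightarrow> int)) set"
     and J :: "(int \<times> int \<times> ((nat \<Rightarrow> int) \<Rightarrow> int)) set" where
    "finite I" "finite J" "\<forall>(c, h)\<in>I. lin h" "\<forall>(N, c, h)\<in>J. lin h \<and> N > 0"
    "\<forall>v d. P (v(k := d)) \<longleftrightarrow>
        (\<forall>(c, h)\<in>I. 0 \<le> c * d + h v) \<and> (\<forall>(N, c, h)\<in>J. N dvd c * d + h v)"
    unfolding conjunct_def by blast
  moreover from assms(2) obtain I' :: "(int \<times> ((nat \<Rightarrow> int) \<Rightarrow> int)) set"
     and J' :: "(int \<times> int \<times> ((nat \<Rightarrow> int) \<Rightarrow> int)) set" where
    "finite I'" "finite J'" "\<forall>(c, h)\<in>I'. lin h" "\<forall>(N, c, h)\<in>J'. lin h \<and> N > 0"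
    "\<forall>v d. Q (v(k := d)) \<longleftrightarrow>
        (\<forall>(c, h)\<in>I'. 0 \<le> c * d + h v) \<and> (\<forall>(N, c, h)\<in>J'. N dvd c * d + h v)"
    unfolding conjunct_def by blast
  ultimately show ?thesis unfolding conjunct_def
    by (intro exI[of _ "I \<union> I'"] exI[of _ "J \<union> J'"]) (simp add: ball_Un, blast)
qed

lemma pos_dnf:
  "pos P \<Longrightarrow> \<exists>\<C>. finite \<C> \<and> (\<forall>C\<in>\<C>. conjunct k C) \<and> (\<forall>v. P v \<longleftrightarrow> (\<exists>C\<in>\<C>. C v))"
proof (induction rule: pos.induct)
  case (pos_ge g)
  then have "conjunct k (\<lambda>v. 0 \<le> g v)" by (rule conjunct_ge)
  then show ?case by (intro exI[of _ "{\<lambda>v. 0 \<le> g v}"]) simp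
next
  case (pos_dvd g N)
  then have "conjunct k (\<lambda>v. N dvd g v)" by (rule conjunct_dvd)
  then show ?case by (intro exI[of _ "{\<lambda>v. N dvd g v}"]) simp
next
  case (pos_conj P Q)
  from pos_conj.IH(1) obtain \<C> where
    C: "finite \<C>" "\<forall>C\<in>\<C>. conjunct k C" "\<forall>v. P v \<longleftrightarrow> (\<exists>C\<in>\<C>. C v)"
    by (elim exE conjE) (rule that)
  from pos_conj.IH(2) obtain \<D> where
    D: "finite \<D>" "\<forall>C\<in>\<D>. conjunct k C" "\<forall>v. Q v \<longleftrightarrow> (\<exists>C\<in>\<D>. C v)"
    by (elim exE conjE) (rule that)
  note CD = C D
  show ?case
  proof (intro exI conjI allI)
    show "finite ((\<lambda>(C, D) v. C v \<and> D v) ` (\<C> \<times> \<D>))" using CD by simp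
    show "\<forall>E\<in>(\<lambda>(C, D) v. C v \<and> D v) ` (\<C> \<times> \<D>). conjunct k E"
    proof clarify
      fix C D assume "C \<in> \<C>" "D \<in> \<D>"
      then show "conjunct k (\<lambda>v. C v \<and> D v)" using CD by (intro conjunct_conj) auto
    qed
    show "(P v \<and> Q v) = (\<exists>E\<in>(\<lambda>(C, D) v. C v \<and> D v) ` (\<C> \<times> \<D>). E v)" for v
      using CD(3,6) by auto
  qed
next
  case (pos_disj P Q)
  from pos_disj.IH(1) obtain \<C> where
    C: "finite \<C>" "\<forall>C\<in>\<C>. conjunct k C" "\<forall>v. P v \<longleftrightarrow> (\<exists>C\<in>\<C>. C v)"
    by (elim exE conjE) (rule that)
  from pos_disj.IH(2) obtain \<D> where
    D: "finite \<D>" "\<forall>C\<in>\<D>. conjunct k C" "\<forall>v. Q v \<longleftrightarrow> (\<exists>C\<in>\<D>. C v)"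
    by (elim exE conjE) (rule that)
  note CD = C D
  show ?case
    by (intro exI[of _ "\<C> \<union> \<D>"]) (simp add: CD ball_Un bex_Un)
qed

text \<open>In \<open>cooper\<close> the coefficients and the ranges of \<open>r\<close> do not
  depend on \<open>v\<close>; only the values \<open>h v\<close> do. So its right-hand side is a
  finite combination of atoms in \<open>v\<close>.\<close>

lemma pos_ex_conjunct:
  assumes "conjunct k P"
  shows "pos (\<lambda>v. \<exists>d. P (v(k := d)))"
proof -
  from assms obtain I :: "(int \<times> ((nat \<Rightarrow> int) \<Rightarrow> int)) set"
     and J :: "(int \<times> int \<times> ((nat \<Rightarrow> int) \<Rightarrow> int)) set" where
    fin: "finite I" "finite J" and I': "\<forall>(c, h)\<in>I. lin h"
    and J': "\<forall>(N, c, h)\<in>J. lin h \<and> N > 0" and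
    P': "\<forall>v d. P (v(k := d)) \<longleftrightarrow>
        (\<forall>(c, h)\<in>I. 0 \<le> c * d + h v) \<and> (\<forall>(N, c, h)\<in>J. N dvd c * d + h v)"
    unfolding conjunct_def by (elim exE conjE) (rule that)
  note P = P'[rule_format]
  have I: "lin h" if "(c, h) \<in> I" for c h using I' that by auto
  have J: "lin h \<and> N > 0" if "(N, c, h) \<in> J" for N c h using J' that by auto
  \<comment> \<open>The product of all moduli serves as common period.\<close>
  define D where "D = prod fst J"
  have D: "N dvd D" if "(N, c, h) \<in> J" for N c h
    using dvd_prodI[OF fin(2) that, of fst] by (simp add: D_def)
  have D0: "D > 0" unfolding D_def using J by (intro prod_pos) auto
  let ?R = "\<lambda>v. (\<exists>(a, p)\<in>I. a > 0 \<and> (\<exists>r\<in>{0..<a * D}. a dvd r - p v \<and>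
        (\<forall>(c, h)\<in>I. 0 \<le> c * (r - p v) + a * h v) \<and>
        (\<forall>(N, c, h)\<in>J. a * N dvd c * (r - p v) + a * h v)))
    \<or> ((\<forall>(a, p)\<in>I. a \<le> 0 \<and> (a = 0 \<longrightarrow> 0 \<le> p v)) \<and>
        (\<exists>r\<in>{0..<D}. \<forall>(N, c, h)\<in>J. N dvd c * r + h v))"
  have "(\<exists>d. P (v(k := d))) \<longleftrightarrow> ?R v" for v
  proof -
    have "finite ((\<lambda>(c, h). (c, h v)) ` I)" using fin by simp
    moreover have "N dvd D" if "(N, c, h) \<in> (\<lambda>(N, c, h). (N, c, h v)) ` J" for N c h
      using that D by auto
    ultimately show ?thesis
      unfolding P using cooper[of "(\<lambda>(c, h). (c, h v)) ` I" D "(\<lambda>(N, c, h). (N, c, h v)) ` J"] D0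
      by (simp add: case_prod_beta)
  qed
  then have "(\<lambda>v. \<exists>d. P (v(k := d))) = ?R" by (intro ext)
  moreover have "pos ?R"
  proof (rule pos_disj)
    have "pos (\<lambda>v. a > 0 \<and> (\<exists>r\<in>{0..<a * D}. a dvd r - p v \<and>
        (\<forall>(c, h)\<in>I. 0 \<le> c * (r - p v) + a * h v) \<and>
        (\<forall>(N, c, h)\<in>J. a * N dvd c * (r - p v) + a * h v)))" if ap: "(a, p) \<in> I" for a p
    proof (cases "a > 0")
      case False
      then show ?thesis using pos_const[of False] by simp
    next
      case True
      have r: "lin (\<lambda>v. r - p v)" for r
        using I[OF ap] by (intro lin_diff lin_const)
      have "pos (\<lambda>v. case x of (c, h) \<Rightarrow> 0 \<le> c * (r - p v) + a * h v)" if "x \<in> I" for r x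
        using that I r by (cases x) (auto intro!: pos_ge lin_add lin_mult)
      moreover have "pos (\<lambda>v. case x of (N, c, h) \<Rightarrow> a * N dvd c * (r - p v) + a * h v)"
        if "x \<in> J" for r x
        using that J r True by (cases x) (auto intro!: pos_dvd lin_add lin_mult)
      moreover have "pos (\<lambda>v. a dvd r - p v)" for r
        using r True by (intro pos_dvd)
      ultimately have "pos (\<lambda>v. \<exists>r\<in>{0..<a * D}. a dvd r - p v \<and>
        (\<forall>(c, h)\<in>I. 0 \<le> c * (r - p v) + a * h v) \<and>
        (\<forall>(N, c, h)\<in>J. a * N dvd c * (r - p v) + a * h v))"
        by (intro pos_Bex pos_conj pos_Ball fin) simp_all
      then show ?thesis using True by simp
    qed
    then have "pos (\<lambda>v. case x of (a, p) \<Rightarrow> a > 0 \<and> (\<exists>r\<in>{0..<a * D}. a dvd r - p v \<and>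
        (\<forall>(c, h)\<in>I. 0 \<le> c * (r - p v) + a * h v) \<and>
        (\<forall>(N, c, h)\<in>J. a * N dvd c * (r - p v) + a * h v)))" if "x \<in> I" for x
      using that by (cases x) simp
    then show "pos (\<lambda>v. \<exists>(a, p)\<in>I. a > 0 \<and> (\<exists>r\<in>{0..<a * D}. a dvd r - p v \<and>
        (\<forall>(c, h)\<in>I. 0 \<le> c * (r - p v) + a * h v) \<and>
        (\<forall>(N, c, h)\<in>J. a * N dvd c * (r - p v) + a * h v)))"
      by (rule pos_Bex[OF fin(1)])
    have "pos (\<lambda>v. case x of (a, p) \<Rightarrow> a \<le> 0 \<and> (a = 0 \<longrightarrow> 0 \<le> p v))" if "x \<in> I" for x
    proof (cases x)
      case (Pair a p)
      have "pos (\<lambda>v. 0 \<le> p v)" using that I Pair by (intro pos_ge) simp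
      then show ?thesis using Pair pos_const[of "a < 0"]
        by (cases a "0 :: int" rule: linorder_cases) (auto simp: pos_const)
    qed
    moreover have "pos (\<lambda>v. case x of (N, c, h) \<Rightarrow> N dvd c * r + h v)" if "x \<in> J" for r x
      using that J by (cases x) (auto intro!: pos_dvd lin_add lin_const)
    ultimately show "pos (\<lambda>v. (\<forall>(a, p)\<in>I. a \<le> 0 \<and> (a = 0 \<longrightarrow> 0 \<le> p v)) \<and>
        (\<exists>r\<in>{0..<D}. \<forall>(N, c, h)\<in>J. N dvd c * r + h v))"
      by (intro pos_conj pos_Ball pos_Bex fin) simp_all
  qed
  ultimately show ?thesis by (simp only:)
qed

lemma pos_ex:
  assumes "pos P"
  shows "pos (\<lambda>v. \<exists>d. P (v(k := d)))"
proof -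
  from pos_dnf[OF assms, of k] obtain \<C> where
    \<C>: "finite \<C>" "\<forall>C\<in>\<C>. conjunct k C" "\<forall>v. P v \<longleftrightarrow> (\<exists>C\<in>\<C>. C v)"
    by (elim exE conjE) (rule that)
  have "pos (\<lambda>v. \<exists>C\<in>\<C>. \<exists>d. C (v(k := d)))"
    using \<C>(1,2) by (intro pos_Bex pos_ex_conjunct) auto
  moreover have "(\<lambda>v. \<exists>C\<in>\<C>. \<exists>d. C (v(k := d))) = (\<lambda>v. \<exists>d. P (v(k := d)))"
    using \<C>(3) by auto
  ultimately show ?thesis by simp
qed

lemma pos_eq: "lin g \<Longrightarrow> lin h \<Longrightarrow> pos (\<lambda>v. g v = h v)"
proof -
  assume "lin g" "lin h"
  then have "pos (\<lambda>v. 0 \<le> g v - h v \<and> 0 \<le> h v - g v)"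
    by (intro pos_conj pos_ge lin_diff)
  moreover have "(\<lambda>v. 0 \<le> g v - h v \<and> 0 \<le> h v - g v) = (\<lambda>v. g v = h v)" by auto
  ultimately show ?thesis by simp
qed

lemma pos_psat: "pos (psat UNIV Zstr \<phi>)"
proof (induction \<phi>)
  case (PEq s t)
  then show ?case using pos_eq[OF lin_teval lin_teval] by simp
next
  case (PLess s t)
  have "pos (\<lambda>v. 0 \<le> teval Zstr t v - teval Zstr s v - 1)"
    by (intro pos_ge lin_diff lin_teval lin_const)
  moreover have "(\<lambda>v. 0 \<le> teval Zstr t v - teval Zstr s v - 1) = psat UNIV Zstr (PLess s t)"
    by (auto simp: fun_eq_iff)
  ultimately show ?case by simp
next
  case (PCong k s t)
  show ?case
  \<comment> \<open>As \<open>x mod 0 = x\<close>, congruence modulo 0 is equality.\<close>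
  proof (cases "k = 0")
    case True
    then show ?thesis using pos_eq[OF lin_teval[of s] lin_teval[of t]] by simp
  next
    case False
    then have "pos (\<lambda>v. int k dvd teval Zstr s v - teval Zstr t v)"
      by (intro pos_dvd lin_diff lin_teval) auto
    moreover have "(\<lambda>v. int k dvd teval Zstr s v - teval Zstr t v) = psat UNIV Zstr (PCong k s t)"
      by (auto simp: fun_eq_iff mod_eq_dvd_iff)
    ultimately show ?thesis by (simp only:)
  qed
next
  case PFalse
  show ?case using pos_const by simp
next
  case (PNot f)
  have "pos (\<lambda>v. \<not> psat UNIV Zstr f v)" by (rule pos_not) (rule PNot)
  then show ?case by simp
next
  case (PAnd f g)
  have "pos (\<lambda>v. psat UNIV Zstr f v \<and> psat UNIV Zstr g v)" by (rule pos_conj) (rule PAnd)+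
  then show ?case by simp
next
  case (PEx k f)
  have "pos (\<lambda>v. \<exists>d. psat UNIV Zstr f (v(k := d)))" by (rule pos_ex) (rule PEx)
  then show ?case by simp
qed

section \<open>Transfer to models\<close>

definition all_closure :: "nat list \<Rightarrow> pfm \<Rightarrow> pfm" where
  "all_closure ks \<phi> = foldr (\<lambda>k f. PNot (PEx k (PNot f))) ks \<phi>"

lemma fv_all_closure: "fv (all_closure ks \<phi>) = fv \<phi> - set ks"
  unfolding all_closure_def by (induction ks) auto

lemma psat_all_closure:
  "(\<forall>v. psat UNIV M (all_closure ks \<phi>) v) \<longleftrightarrow> (\<forall>v. psat UNIV M \<phi> v)"
proof (induction ks)
  case Nil
  then show ?case by (simp add: all_closure_def)
next
  case (Cons k ks)
  have "(\<forall>v. psat UNIV M (all_closure (k # ks) \<phi>) v) \<longleftrightarrow>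
    (\<forall>v d. psat UNIV M (all_closure ks \<phi>) (v(k := d)))"
    by (simp add: all_closure_def)
  also have "\<dots> \<longleftrightarrow> (\<forall>v. psat UNIV M (all_closure ks \<phi>) v)"
    by (metis fun_upd_triv)
  finally show ?case using Cons by simp
qed

text \<open>\<open>models_Pres\<close> speaks of sentences only; the universal closure carries over
  formulas with free variables.\<close>

lemma models_Pres_transfer:
  assumes "models_Pres M" "\<And>v. psat UNIV Zstr \<phi> v"
  shows "psat UNIV M \<phi> v"
proof -
  obtain ks where "set ks = fv \<phi>" using finite_list[OF finite_fv] by blast
  then have "fv (all_closure ks \<phi>) = {}" by (simp add: fv_all_closure)
  moreover have "\<forall>v. psat UNIV Zstr (all_closure ks \<phi>) v"
    using assms(2) by (simp add: psat_all_closure)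
  ultimately have "\<forall>v. psat UNIV M (all_closure ks \<phi>) v"
    by (rule assms(1)[unfolded models_Pres_def, THEN spec, THEN mp, THEN mp])
  then show ?thesis by (simp only: psat_all_closure)
qed

section \<open>Cell decomposition\<close>

abbreviation PIff :: "pfm \<Rightarrow> pfm \<Rightarrow> pfm" where
  "PIff f g \<equiv> PAnd (PNot (PAnd f (PNot g))) (PNot (PAnd g (PNot f)))"

definition list_conj :: "pfm list \<Rightarrow> pfm" where
  "list_conj fs = foldr PAnd fs (PNot PFalse)"

lemma psat_list_conj [simp]: "psat D M (list_conj fs) v \<longleftrightarrow> (\<forall>f\<in>set fs. psat D M f v)"
  unfolding list_conj_def by (induction fs) auto

text \<open>A cell \<open>(P, C, E)\<close> consists of inequalities \<open>L <= T\<close>, a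
  condition \<open>C\<close> on the point and a condition \<open>E\<close> on the parameters. By
  \<open>wf_cell\<close>, point and parameters meet only in \<open>P\<close>, and there on opposite
  sides.\<close>

type_synonym cell = "(ptm \<times> ptm) list \<times> pfm \<times> pfm"

definition in_cell :: "'m pstruct \<Rightarrow> (nat \<Rightarrow> 'm) \<Rightarrow> cell \<Rightarrow> bool" where
  "in_cell M v = (\<lambda>(P, C, E). (\<forall>(L, T)\<in>set P. \<not> pless M (teval M T v) (teval M L v)) \<and>
     psat UNIV M C v \<and> psat UNIV M E v)"

definition wf_cell :: "nat \<Rightarrow> cell \<Rightarrow> bool" where
  "wf_cell n = (\<lambda>(P, C, E). (\<forall>(L, T)\<in>set P. tvars L \<subseteq> {..<n} \<and> tvars T \<inter> {..<n} = {}) \<and>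
     fv C \<subseteq> {..<n} \<and> fv E \<inter> {..<n} = {})"

definition cell_fm :: "cell \<Rightarrow> pfm" where
  "cell_fm = (\<lambda>(P, C, E). PAnd (list_conj (map (\<lambda>(L, T). PNot (PLess T L)) P)) (PAnd C E))"

lemma psat_cell_fm: "psat UNIV M (cell_fm c) v \<longleftrightarrow> in_cell M v c"
  by (cases c) (auto simp: cell_fm_def in_cell_def)

lemma term_split:
  "\<exists>s r. tvars s \<subseteq> A \<and> tvars r \<inter> A = {} \<and> (\<forall>v. teval Zstr t v = teval Zstr s v + teval Zstr r v)"
proof (induction t)
  case (PVar i)
  show ?case
  proof (cases "i \<in> A")
    case True
    then show ?thesis by (intro exI[of _ "PVar i"] exI[of _ PZero]) simp
  next
    case False
    then show ?thesis by (intro exI[of _ PZero] exI[of _ "PVar i"]) simp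
  qed
next
  case PZero
  show ?case by (intro exI[of _ PZero]) simp
next
  case POne
  show ?case by (intro exI[of _ PZero] exI[of _ POne]) simp
next
  case (PPlus t u)
  then obtain s r s' r' where
    "tvars s \<subseteq> A" "tvars r \<inter> A = {}" "\<forall>v. teval Zstr t v = teval Zstr s v + teval Zstr r v"
    "tvars s' \<subseteq> A" "tvars r' \<inter> A = {}" "\<forall>v. teval Zstr u v = teval Zstr s' v + teval Zstr r' v"
    by (elim exE conjE) (rule that)
  then show ?case by (intro exI[of _ "PPlus s s'"] exI[of _ "PPlus r r'"]) auto
next
  case (PMinus t u)
  then obtain s r s' r' where
    "tvars s \<subseteq> A" "tvars r \<inter> A = {}" "\<forall>v. teval Zstr t v = teval Zstr s v + teval Zstr r v"
    "tvars s' \<subseteq> A" "tvars r' \<inter> A = {}" "\<forall>v. teval Zstr u v = teval Zstr s' v + teval Zstr r' v"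
    by (elim exE conjE) (rule that)
  then show ?case by (intro exI[of _ "PMinus s s'"] exI[of _ "PMinus r r'"]) auto
qed

definition cellular :: "nat \<Rightarrow> ((nat \<Rightarrow> int) \<Rightarrow> bool) \<Rightarrow> bool" where
  "cellular n P \<longleftrightarrow>
     (\<exists>cs. (\<forall>c\<in>set cs. wf_cell n c) \<and> (\<forall>v. P v \<longleftrightarrow> (\<exists>c\<in>set cs. in_cell Zstr v c)))"

lemma cellularI:
  "\<lbrakk>\<And>c. c \<in> set cs \<Longrightarrow> wf_cell n c; \<And>v. P v \<longleftrightarrow> (\<exists>c\<in>set cs. in_cell Zstr v c)\<rbrakk> \<Longrightarrow> cellular n P"
  unfolding cellular_def by (rule exI[of _ cs]) simp

lemma cellularE:
  assumes "cellular n P"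
  obtains cs where "\<forall>c\<in>set cs. wf_cell n c" "\<forall>v. P v \<longleftrightarrow> (\<exists>c\<in>set cs. in_cell Zstr v c)"
  using assms unfolding cellular_def by (elim exE conjE)

lemma cellular_ge:
  assumes "lin g"
  shows "cellular n (\<lambda>v. 0 \<le> g v)"
proof -
  obtain t where t: "g = teval Zstr t" using assms by (auto simp: lin_def)
  from term_split[of "{..<n}" t] obtain s r where
    sr: "tvars s \<subseteq> {..<n}" "tvars r \<inter> {..<n} = {}"
      "\<forall>v. teval Zstr t v = teval Zstr s v + teval Zstr r v"
    by (elim exE conjE) (rule that)
  show ?thesis
    by (rule cellularI[of "[([(PMinus PZero s, r)], PNot PFalse, PNot PFalse)]"])
      (auto simp: in_cell_def wf_cell_def sr t)
qed

text \<open>A divisibility involving both point and parameters is separated by the residue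
  \<open>i\<close> of the point part \<open>s\<close>: the parameter part \<open>r\<close> must then
  have residue \<open>- i\<close>. Each of the \<open>N\<close> cases is one cell without
  inequalities.\<close>

lemma cellular_dvd:
  assumes "lin g" "0 < N"
  shows "cellular n (\<lambda>v. N dvd g v)"
proof -
  obtain t where t: "g = teval Zstr t" using assms by (auto simp: lin_def)
  from term_split[of "{..<n}" t] obtain s r where
    sr: "tvars s \<subseteq> {..<n}" "tvars r \<inter> {..<n} = {}"
      "\<forall>v. teval Zstr t v = teval Zstr s v + teval Zstr r v"
    by (elim exE conjE) (rule that)
  define ct where "ct i = (SOME t. tvars t = {} \<and> (\<forall>v. teval Zstr t v = i))" for i :: int
  have ct: "tvars (ct i) = {}" "teval Zstr (ct i) v = i" for i v
    using someI_ex[OF ex_const_term[of i]] unfolding ct_def by simp_all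
  define cs where "cs = map (\<lambda>i. ([] :: (ptm \<times> ptm) list,
     PCong (nat N) s (ct i), PCong (nat N) r (ct (- i)))) [0..N - 1]"
  show ?thesis
  proof (rule cellularI[of cs])
    show "wf_cell n c" if "c \<in> set cs" for c
      using that sr ct by (auto simp: cs_def wf_cell_def)
    fix v
    have "N dvd a + b \<longleftrightarrow> (\<exists>i\<in>{0..N - 1}. a mod N = i mod N \<and> b mod N = - i mod N)" for a b
    proof
      assume "N dvd a + b"
      then have "b mod N = - a mod N" by (simp add: mod_eq_dvd_iff add.commute)
      moreover have "- (a mod N) mod N = - a mod N" by (rule mod_minus_eq)
      moreover have "a mod N \<in> {0..N - 1}" using assms(2) by simp
      ultimately show "\<exists>i\<in>{0..N - 1}. a mod N = i mod N \<and> b mod N = - i mod N"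
        by (intro bexI[of _ "a mod N"]) simp_all
    next
      assume "\<exists>i\<in>{0..N - 1}. a mod N = i mod N \<and> b mod N = - i mod N"
      then obtain i where "a mod N = i mod N" "b mod N = - i mod N" by blast
      then have "N dvd a - i" "N dvd b - - i" by (simp_all only: mod_eq_dvd_iff)
      then have "N dvd (a - i) + (b - - i)" by (rule dvd_add)
      then show "N dvd a + b" by simp
    qed
    then show "N dvd g v \<longleftrightarrow> (\<exists>c\<in>set cs. in_cell Zstr v c)"
      using assms(2) by (simp add: t sr cs_def in_cell_def ct)
  qed
qed

lemma cellular_disj:
  assumes "cellular n P" "cellular n Q"
  shows "cellular n (\<lambda>v. P v \<or> Q v)"
proof -
  obtain cs where "\<forall>c\<in>set cs. wf_cell n c" "\<forall>v. P v \<longleftrightarrow> (\<exists>c\<in>set cs. in_cell Zstr v c)"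
    using assms(1) by (rule cellularE)
  moreover obtain ds where
    "\<forall>c\<in>set ds. wf_cell n c" "\<forall>v. Q v \<longleftrightarrow> (\<exists>c\<in>set ds. in_cell Zstr v c)"
    using assms(2) by (rule cellularE)
  ultimately show ?thesis by (intro cellularI[of "cs @ ds"]) auto
qed

lemma cellular_conj:
  assumes "cellular n P" "cellular n Q"
  shows "cellular n (\<lambda>v. P v \<and> Q v)"
proof -
  obtain cs where
    cs: "\<forall>c\<in>set cs. wf_cell n c" "\<forall>v. P v \<longleftrightarrow> (\<exists>c\<in>set cs. in_cell Zstr v c)"
    using assms(1) by (rule cellularE)
  obtain ds where
    ds: "\<forall>c\<in>set ds. wf_cell n c" "\<forall>v. Q v \<longleftrightarrow> (\<exists>c\<in>set ds. in_cell Zstr v c)"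
    using assms(2) by (rule cellularE)
  define m :: "cell \<times> cell \<Rightarrow> cell"
    where "m = (\<lambda>((P, C, E), (P', C', E')). (P @ P', PAnd C C', PAnd E E'))"
  have m: "in_cell Zstr v (m (c, d)) \<longleftrightarrow> in_cell Zstr v c \<and> in_cell Zstr v d" for c d v
    by (cases c; cases d) (auto simp: m_def in_cell_def)
  have wf: "wf_cell n (m (c, d))" if "wf_cell n c" "wf_cell n d" for c d
    using that by (cases c; cases d) (auto simp: m_def wf_cell_def)
  show ?thesis
  proof (rule cellularI[of "map m (List.product cs ds)"])
    fix e assume "e \<in> set (map m (List.product cs ds))"
    then obtain c d where "e = m (c, d)" "c \<in> set cs" "d \<in> set ds" by auto
    then show "wf_cell n e" using wf cs(1) ds(1) by blast
  next
    fix v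
    have "(\<exists>e\<in>set (map m (List.product cs ds)). in_cell Zstr v e) \<longleftrightarrow>
      (\<exists>c\<in>set cs. \<exists>d\<in>set ds. in_cell Zstr v (m (c, d)))" by auto
    then show "P v \<and> Q v \<longleftrightarrow> (\<exists>e\<in>set (map m (List.product cs ds)). in_cell Zstr v e)"
      by (simp only: m cs(2) ds(2)) blast
  qed
qed

lemma pos_cellular: "pos P \<Longrightarrow> cellular n P"
proof (induction rule: pos.induct)
  case (pos_ge g)
  then show ?case by (rule cellular_ge)
next
  case (pos_dvd g N)
  then show ?case by (rule cellular_dvd)
next
  case (pos_conj P Q)
  show ?case by (rule cellular_conj) (rule pos_conj.IH)+
next
  case (pos_disj P Q)
  show ?case by (rule cellular_disj) (rule pos_disj.IH)+
qed

text \<open>Well-formedness of cells is syntactic and needs no transfer; what is transferred is the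
  one formula \<open>?f\<close>, which equates \<phi> with the disjunction of the cells.\<close>

lemma cell_decomposition:
  assumes M: "models_Pres M"
  shows "\<exists>cs. (\<forall>c\<in>set cs. wf_cell n c) \<and> (\<forall>v. psat UNIV M \<phi> v \<longleftrightarrow> (\<exists>c\<in>set cs. in_cell M v c))"
proof -
  obtain cs where cs: "\<forall>c\<in>set cs. wf_cell n c"
    "\<forall>v. psat UNIV Zstr \<phi> v \<longleftrightarrow> (\<exists>c\<in>set cs. in_cell Zstr v c)"
    by (rule cellularE[OF pos_cellular[OF pos_psat]])
  let ?f = "PIff \<phi> (PNot (list_conj (map (\<lambda>c. PNot (cell_fm c)) cs)))"
  have "psat UNIV M \<phi> v \<longleftrightarrow> (\<exists>c\<in>set cs. in_cell M v c)" for v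
  proof -
    have "psat UNIV M ?f v"
      by (rule models_Pres_transfer[OF M]) (simp add: psat_cell_fm cs(2), blast)
    then show ?thesis by (simp add: psat_cell_fm) blast
  qed
  then show ?thesis using cs(1) by (intro exI[of _ cs]) simp
qed

section \<open>Order facts\<close>

text \<open>The fresh variable \<open>y\<close> is the upper bound; \<open>z\<close> ranges over the elements larger than the maximum.\<close>
definition max_fm :: "nat \<Rightarrow> nat \<Rightarrow> nat \<Rightarrow> pfm \<Rightarrow> pfm" where
  "max_fm k y z \<psi> = PNot (PAnd (PAnd (PEx k \<psi>) (PNot (PEx k (PAnd \<psi> (PLess (PVar y) (PVar k))))))
    (PNot (PEx k (PAnd \<psi> (PNot (PEx z (PAnd (PLess (PVar k) (PVar z))
      (PEx k (PAnd (PEq (PVar k) (PVar z)) \<psi>)))))))))"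

lemma psat_max_fm:
  assumes "y \<notin> insert k (fv \<psi>)" "z \<notin> insert y (insert k (fv \<psi>))"
  shows "psat UNIV M (max_fm k y z \<psi>) w \<longleftrightarrow> ((\<exists>d. psat UNIV M \<psi> (w(k := d))) \<and>
      (\<forall>d. psat UNIV M \<psi> (w(k := d)) \<longrightarrow> \<not> pless M (w y) d) \<longrightarrow>
      (\<exists>g. psat UNIV M \<psi> (w(k := g)) \<and> (\<forall>e. psat UNIV M \<psi> (w(k := e)) \<longrightarrow> \<not> pless M g e)))"
proof -
  have eq: "psat UNIV M \<psi> (w(k := g, z := e, k := d)) = psat UNIV M \<psi> (w(k := d))" for g e d
    by (rule psat_cong) (use assms in auto)
  \<comment> \<open>Quantifying \<open>k\<close> anew and equating it with \<open>z\<close>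
    evaluates \<psi> at \<open>z\<close> without a substitution.\<close>
  have "psat UNIV M (PEx k (PAnd (PEq (PVar k) (PVar z)) \<psi>)) (w(k := g, z := e)) \<longleftrightarrow>
      psat UNIV M \<psi> (w(k := e))" for g e
    using assms eq by simp
  then show ?thesis
    using assms unfolding max_fm_def psat.simps by auto
qed

lemma int_bdd_above_max:
  fixes P :: "int \<Rightarrow> bool"
  assumes "P d" "\<forall>d. P d \<longrightarrow> \<not> u < d"
  shows "\<exists>g. P g \<and> (\<forall>e. P e \<longrightarrow> \<not> g < e)"
proof -
  obtain g where "P g" "\<forall>e. P e \<longrightarrow> nat (u - g) \<le> nat (u - e)"
    using ex_has_least_nat[of P d "\<lambda>d. nat (u - d)"] assms(1) by blast
  then show ?thesis using assms(2) by (intro exI[of _ g]) (auto simp: not_less nat_le_eq_zle)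
qed

locale pres =
  fixes M :: "'m pstruct"
  assumes models: "models_Pres M"
begin

abbreviation less (infix "\<prec>" 50) where "x \<prec> y \<equiv> pless M x y"
abbreviation less_eq (infix "\<preceq>" 50) where "x \<preceq> y \<equiv> \<not> y \<prec> x"
abbreviation suc :: "'m \<Rightarrow> 'm" where "suc x \<equiv> pplus M x (pone M)"

lemma less_irrefl: "\<not> x \<prec> x"
  using models_Pres_transfer[OF models, of "PNot (PLess (PVar 0) (PVar 0))" "\<lambda>_. x"] by simp

lemma less_trans: "x \<prec> y \<Longrightarrow> y \<prec> z \<Longrightarrow> x \<prec> z"
  using models_Pres_transfer[OF models, of "PNot (PAnd (PAnd (PLess (PVar 0) (PVar 1)) (PLess (PVar 1) (PVar 2)))
    (PNot (PLess (PVar 0) (PVar 2))))" "(\<lambda>_. x)(1 := y, 2 := z)"] by simp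

lemma less_linear: "x \<prec> y \<or> x = y \<or> y \<prec> x"
  using models_Pres_transfer[OF models, of "PNot (PAnd (PAnd (PNot (PLess (PVar 0) (PVar 1)))
    (PNot (PLess (PVar 1) (PVar 0)))) (PNot (PEq (PVar 0) (PVar 1))))" "(\<lambda>_. x)(1 := y)"]
  by fastforce

sublocale ord: linorder "\<lambda>x y. x \<preceq> y" "\<lambda>x y. x \<prec> y"
  by unfold_locales (metis less_irrefl less_trans less_linear)+

lemma less_suc: "x \<prec> suc x"
  using models_Pres_transfer[OF models, of "PLess (PVar 0) (PPlus (PVar 0) POne)" "\<lambda>_. x"] by simp

lemma suc_le: "x \<prec> y \<Longrightarrow> suc x \<preceq> y"
  using models_Pres_transfer[OF models, of "PNot (PAnd (PLess (PVar 0) (PVar 1))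
    (PLess (PVar 1) (PPlus (PVar 0) POne)))" "(\<lambda>_. x)(1 := y)"] by simp

lemma less_suc_le: "x \<prec> suc y \<Longrightarrow> x \<preceq> y"
  using suc_le by blast

abbreviation neg :: "'m \<Rightarrow> 'm" where "neg x \<equiv> pminus M (pzero M) x"

lemma neg_less_bounds:
  "neg b \<prec> x \<Longrightarrow> x \<prec> b \<Longrightarrow> neg c \<prec> y \<Longrightarrow> y \<prec> c \<Longrightarrow>
    neg (pplus M b c) \<prec> pplus M x y \<and> pplus M x y \<prec> pplus M b c \<and>
    neg (pplus M b c) \<prec> pminus M x y \<and> pminus M x y \<prec> pplus M b c"
  using models_Pres_transfer[OF models, of "PNot (PAnd (PAnd (PAnd (PLess (PMinus PZero (PVar 0)) (PVar 2))
    (PLess (PVar 2) (PVar 0))) (PAnd (PLess (PMinus PZero (PVar 1)) (PVar 3)) (PLess (PVar 3) (PVar 1))))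
    (PNot (PAnd (PAnd (PLess (PMinus PZero (PPlus (PVar 0) (PVar 1))) (PPlus (PVar 2) (PVar 3)))
      (PLess (PPlus (PVar 2) (PVar 3)) (PPlus (PVar 0) (PVar 1))))
      (PAnd (PLess (PMinus PZero (PPlus (PVar 0) (PVar 1))) (PMinus (PVar 2) (PVar 3)))
      (PLess (PMinus (PVar 2) (PVar 3)) (PPlus (PVar 0) (PVar 1)))))))"
    "(\<lambda>_. b)(1 := c, 2 := x, 3 := y)"] by simp

lemma const_bounds:
  "neg (pone M) \<prec> pzero M" "pzero M \<prec> pone M"
  "neg (suc (pone M)) \<prec> pone M" "pone M \<prec> suc (pone M)"
  using models_Pres_transfer[OF models, of "PLess (PMinus PZero POne) PZero"] models_Pres_transfer[OF models, of "PLess PZero POne"]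
    models_Pres_transfer[OF models, of "PLess (PMinus PZero (PPlus POne POne)) POne"]
    models_Pres_transfer[OF models, of "PLess POne (PPlus POne POne)"] by simp_all

text \<open>The bound depends on \<open>L\<close> and \<alpha> but not on the point, so over a
  bounded set it can serve as an end of a single strip.\<close>

lemma term_bounded:
  assumes "tvars L \<subseteq> A"
  shows "\<exists>\<beta>. \<forall>x. (\<forall>i\<in>A. neg \<alpha> \<prec> x i \<and> x i \<prec> \<alpha>) \<longrightarrow> neg \<beta> \<prec> teval M L x \<and> teval M L x \<prec> \<beta>"
  using assms
proof (induction L)
  case (PVar i)
  then show ?case by (intro exI[of _ \<alpha>]) auto
next
  case PZero
  show ?case using const_bounds by (intro exI[of _ "pone M"]) auto
next
  case POne
  show ?case using const_bounds by (intro exI[of _ "suc (pone M)"]) auto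
next
  case (PPlus s t)
  then obtain b c where
    "\<forall>x. (\<forall>i\<in>A. neg \<alpha> \<prec> x i \<and> x i \<prec> \<alpha>) \<longrightarrow> neg b \<prec> teval M s x \<and> teval M s x \<prec> b"
    "\<forall>x. (\<forall>i\<in>A. neg \<alpha> \<prec> x i \<and> x i \<prec> \<alpha>) \<longrightarrow> neg c \<prec> teval M t x \<and> teval M t x \<prec> c"
    by auto
  then have "\<forall>x. (\<forall>i\<in>A. neg \<alpha> \<prec> x i \<and> x i \<prec> \<alpha>) \<longrightarrow>
      neg b \<prec> teval M s x \<and> teval M s x \<prec> b \<and> neg c \<prec> teval M t x \<and> teval M t x \<prec> c"
    by blast
  then show ?case
    unfolding teval.simps by (intro exI[of _ "pplus M b c"]) (metis neg_less_bounds)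
next
  case (PMinus s t)
  then obtain b c where
    "\<forall>x. (\<forall>i\<in>A. neg \<alpha> \<prec> x i \<and> x i \<prec> \<alpha>) \<longrightarrow> neg b \<prec> teval M s x \<and> teval M s x \<prec> b"
    "\<forall>x. (\<forall>i\<in>A. neg \<alpha> \<prec> x i \<and> x i \<prec> \<alpha>) \<longrightarrow> neg c \<prec> teval M t x \<and> teval M t x \<prec> c"
    by auto
  then have "\<forall>x. (\<forall>i\<in>A. neg \<alpha> \<prec> x i \<and> x i \<prec> \<alpha>) \<longrightarrow>
      neg b \<prec> teval M s x \<and> teval M s x \<prec> b \<and> neg c \<prec> teval M t x \<and> teval M t x \<prec> c"
    by blast
  then show ?case
    unfolding teval.simps by (intro exI[of _ "pplus M b c"]) (metis neg_less_bounds)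
qed

lemma infinite_UNIV_M: "infinite (UNIV :: 'm set)"
proof
  assume fin: "finite (UNIV :: 'm set)"
  then show False using ord.Max_ge[OF fin, of "suc (ord.Max UNIV)"] less_suc by blast
qed

text \<open>The maximum principle holds in the integers for every formula, and for a given \<psi> it
  is itself one formula, in which \<open>u\<close> and the other parameters are values of free
  variables; so it transfers.\<close>

lemma psat_max:
  assumes l: "psat UNIV M \<psi> (v(k := l))" and u: "\<And>d. psat UNIV M \<psi> (v(k := d)) \<Longrightarrow> d \<preceq> u"
  shows "\<exists>g. psat UNIV M \<psi> (v(k := g)) \<and> (\<forall>d. psat UNIV M \<psi> (v(k := d)) \<longrightarrow> d \<preceq> g)"
proof -
  obtain y where y: "y \<notin> insert k (fv \<psi>)"
    using finite_fv infinite_UNIV_nat by (metis ex_new_if_finite finite_insert)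
  obtain z where z: "z \<notin> insert y (insert k (fv \<psi>))"
    using finite_fv infinite_UNIV_nat by (metis ex_new_if_finite finite_insert)
  have "psat UNIV Zstr (max_fm k y z \<psi>) w" for w
    unfolding psat_max_fm[OF y z] Zstr_sel
  proof (intro impI, elim conjE exE)
    fix d
    assume "psat UNIV Zstr \<psi> (w(k := d))" "\<forall>d. psat UNIV Zstr \<psi> (w(k := d)) \<longrightarrow> \<not> w y < d"
    then show "\<exists>g. psat UNIV Zstr \<psi> (w(k := g)) \<and> (\<forall>e. psat UNIV Zstr \<psi> (w(k := e)) \<longrightarrow> \<not> g < e)"
      by (rule int_bdd_above_max)
  qed
  then have *: "psat UNIV M (max_fm k y z \<psi>) (v(y := u))"
    by (rule models_Pres_transfer[OF models])
  have eq: "psat UNIV M \<psi> ((v(y := u))(k := d)) = psat UNIV M \<psi> (v(k := d))" for d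
    by (rule psat_cong) (use y in auto)
  show ?thesis
    using *[unfolded psat_max_fm[OF y z] eq, THEN mp] l u by (simp only: fun_upd_same) blast
qed

end

section \<open>Definable relations and elementary maps\<close>

text \<open>The layout of \<open>merge\<close>, with sequences in place of tuples: arguments at even
  variables, parameters at odd ones.\<close>

definition mix :: "(nat \<Rightarrow> 'm) \<Rightarrow> (nat \<Rightarrow> 'm) \<Rightarrow> nat \<Rightarrow> 'm" where
  "mix x c = (\<lambda>i. if even i then x (i div 2) else c (i div 2))"

lemma mix_upd: "(mix x c)(2 * k := d) = mix (x(k := d)) c"
  by (auto simp: mix_def fun_eq_iff)

lemma comp_mix: "f \<circ> mix x c = mix (f \<circ> x) (f \<circ> c)"
  by (auto simp: mix_def fun_eq_iff)

text \<open>\<open>R x f\<close> is a formula in the variables \<open>x\<close> with parameters from \<open>B\<close>, each parameter \<open>b\<close>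
  having been replaced by \<open>f b\<close>. So \<open>R x id\<close> is the relation itself, and \<open>R x f\<close> is its
  image under a partial elementary map \<open>f\<close>.\<close>
definition dfn :: "'m pstruct \<Rightarrow> 'm set \<Rightarrow> ((nat \<Rightarrow> 'm) \<Rightarrow> ('m \<Rightarrow> 'm) \<Rightarrow> bool) \<Rightarrow> bool" where
  "dfn M B R \<longleftrightarrow>
     (\<exists>\<psi> c. range c \<subseteq> B \<and> (\<forall>x f. R x f \<longleftrightarrow> psat UNIV M \<psi> (mix x (f \<circ> c))))"

lemma dfnI:
  "range c \<subseteq> B \<Longrightarrow> (\<And>x f. R x f \<longleftrightarrow> psat UNIV M \<psi> (mix x (f \<circ> c))) \<Longrightarrow> dfn M B R"
  unfolding dfn_def by (intro exI[of _ \<psi>] exI[of _ c]) simp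

lemma dfnE:
  assumes "dfn M B R"
  obtains \<psi> c where "range c \<subseteq> B" "\<forall>x f. R x f \<longleftrightarrow> psat UNIV M \<psi> (mix x (f \<circ> c))"
  using assms unfolding dfn_def by (elim exE conjE)

lemma dfn_mono: "dfn M B R \<Longrightarrow> B \<subseteq> B' \<Longrightarrow> dfn M B' R"
  unfolding dfn_def by (meson order_trans)

lemma dfn_fm:
  assumes "b \<in> B" "\<And>i m. i \<in> fv \<phi> \<Longrightarrow> h i = Inr m \<Longrightarrow> m \<in> B"
  shows "dfn M B (\<lambda>x f. psat UNIV M \<phi> (\<lambda>i. case h i of Inl j \<Rightarrow> x j | Inr m \<Rightarrow> f m))"
proof -
  define \<rho> where "\<rho> i = (case h i of Inl j \<Rightarrow> 2 * j | Inr m \<Rightarrow> 2 * i + 1)" for i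
  \<comment> \<open>The parameter of variable \<open>i\<close> sits at place \<open>i\<close> of
    \<open>c\<close>; places that hold no parameter of \<phi> get \<open>b\<close>, which keeps the
    range in \<open>B\<close>.\<close>
  define c where "c i = (if i \<in> fv \<phi> then case h i of Inl j \<Rightarrow> b | Inr m \<Rightarrow> m else b)" for i
  from rename_fm[of \<rho> \<phi> UNIV M] obtain \<psi> where
    \<psi>: "\<forall>v. psat UNIV M \<psi> v = psat UNIV M \<phi> (v \<circ> \<rho>)" by (elim exE conjE)
  show ?thesis
  proof (rule dfnI)
    show "range c \<subseteq> B" using assms by (auto simp: c_def split: sum.split)
    fix x f
    have "psat UNIV M \<phi> (\<lambda>i. case h i of Inl j \<Rightarrow> x j | Inr m \<Rightarrow> f m) =
        psat UNIV M \<phi> (mix x (f \<circ> c) \<circ> \<rho>)"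
      by (rule psat_cong) (auto simp: \<rho>_def c_def mix_def split: sum.split)
    then show "psat UNIV M \<phi> (\<lambda>i. case h i of Inl j \<Rightarrow> x j | Inr m \<Rightarrow> f m) \<longleftrightarrow>
        psat UNIV M \<psi> (mix x (f \<circ> c))"
      by (simp only: \<psi>)
  qed
qed

lemma dfn_psat: "b \<in> B \<Longrightarrow> dfn M B (\<lambda>x f. psat UNIV M \<phi> x)"
  using dfn_fm[of b B \<phi> Inl M] by simp

lemma dfn_not:
  assumes "dfn M B R"
  shows "dfn M B (\<lambda>x f. \<not> R x f)"
proof -
  obtain \<psi> c where "range c \<subseteq> B" "\<forall>x f. R x f \<longleftrightarrow> psat UNIV M \<psi> (mix x (f \<circ> c))"
    using assms by (rule dfnE)
  then show ?thesis by (intro dfnI[of c B _ M "PNot \<psi>"]) simp_all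
qed

lemma dfn_ren:
  assumes "dfn M B R"
  shows "dfn M B (\<lambda>x f. R (x \<circ> \<rho>) f)"
proof -
  obtain \<psi> c where c: "range c \<subseteq> B" "\<forall>x f. R x f \<longleftrightarrow> psat UNIV M \<psi> (mix x (f \<circ> c))"
    using assms by (rule dfnE)
  define \<sigma> where "\<sigma> i = (if even i then 2 * \<rho> (i div 2) else i)" for i
  from rename_fm[of \<sigma> \<psi> UNIV M] obtain \<psi>' where
    \<psi>': "\<forall>v. psat UNIV M \<psi>' v = psat UNIV M \<psi> (v \<circ> \<sigma>)" by (elim exE conjE)
  have "mix x d \<circ> \<sigma> = mix (x \<circ> \<rho>) d" for x d :: "nat \<Rightarrow> 'a"
    by (auto simp: mix_def \<sigma>_def fun_eq_iff)
  then show ?thesis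
    using c(1) by (intro dfnI[of c B _ M \<psi>']) (simp_all only: c(2) \<psi>')
qed

lemma dfn_conj:
  assumes "dfn M B R" "dfn M B S"
  shows "dfn M B (\<lambda>x f. R x f \<and> S x f)"
proof -
  obtain \<psi> c where c: "range c \<subseteq> B" "\<forall>x f. R x f \<longleftrightarrow> psat UNIV M \<psi> (mix x (f \<circ> c))"
    using assms(1) by (rule dfnE)
  obtain \<chi> d where d: "range d \<subseteq> B" "\<forall>x f. S x f \<longleftrightarrow> psat UNIV M \<chi> (mix x (f \<circ> d))"
    using assms(2) by (rule dfnE)
  \<comment> \<open>The two parameter sequences are interleaved as \<open>mix c d\<close>;
    \<open>\<sigma> e\<close> redirects the j-th parameter to place \<open>2 * j + e\<close> of it
    and leaves the arguments alone.\<close>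
  define \<sigma> where "\<sigma> e i = (if even i then i else 2 * (2 * (i div 2) + e) + 1)" for e i :: nat
  from rename_fm[of "\<sigma> 0" \<psi> UNIV M] obtain \<psi>' where
    \<psi>': "\<forall>v. psat UNIV M \<psi>' v = psat UNIV M \<psi> (v \<circ> \<sigma> 0)" by (elim exE conjE)
  from rename_fm[of "\<sigma> 1" \<chi> UNIV M] obtain \<chi>' where
    \<chi>': "\<forall>v. psat UNIV M \<chi>' v = psat UNIV M \<chi> (v \<circ> \<sigma> 1)" by (elim exE conjE)
  have m: "mix x (f \<circ> mix c d) \<circ> \<sigma> 0 = mix x (f \<circ> c)" "mix x (f \<circ> mix c d) \<circ> \<sigma> 1 = mix x (f \<circ> d)"
    for x and f :: "'a \<Rightarrow> 'a"
    by (auto simp: mix_def \<sigma>_def fun_eq_iff elim!: oddE)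
  show ?thesis
  proof (rule dfnI)
    show "range (mix c d) \<subseteq> B" using c(1) d(1) by (auto simp: mix_def)
    show "R x f \<and> S x f \<longleftrightarrow> psat UNIV M (PAnd \<psi>' \<chi>') (mix x (f \<circ> mix c d))" for x f
      by (simp only: psat.simps \<psi>' \<chi>' m c(2) d(2))
  qed
qed

lemma dfn_const: "b \<in> B \<Longrightarrow> dfn M B (\<lambda>x f. P)"
  using dfn_psat[of b B M PFalse] dfn_psat[of b B M "PNot PFalse"] by (cases P) simp_all

lemma dfn_Ball:
  assumes "b \<in> B" "finite S" "\<And>s. s \<in> S \<Longrightarrow> dfn M B (R s)"
  shows "dfn M B (\<lambda>x f. \<forall>s\<in>S. R s x f)"
  using assms(2,3)
proof (induction S)
  case empty
  show ?case using dfn_const[OF assms(1), of M True] by simp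
next
  case (insert s S)
  then have "dfn M B (\<lambda>x f. R s x f \<and> (\<forall>s\<in>S. R s x f))" by (intro dfn_conj) simp_all
  then show ?case by simp
qed

lemma dfn_ex:
  assumes "dfn M B R"
  shows "dfn M B (\<lambda>x f. \<exists>d. R (x(k := d)) f)"
proof -
  obtain \<psi> c where c: "range c \<subseteq> B" "\<forall>x f. R x f \<longleftrightarrow> psat UNIV M \<psi> (mix x (f \<circ> c))"
    using assms by (rule dfnE)
  show ?thesis
    by (rule dfnI[of c B _ M "PEx (2 * k) \<psi>"]) (simp_all add: c mix_upd)
qed

lemma dfn_ex_block:
  assumes "dfn M B R"
  shows "dfn M B (\<lambda>x f. \<exists>y. R (\<lambda>i. if i < n then y i else x i) f)"
proof (induction n)
  case 0
  then show ?case using assms by simp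
next
  case (Suc n)
  have "(\<exists>y. R (\<lambda>i. if i < Suc n then y i else x i) f) \<longleftrightarrow>
    (\<exists>d. \<exists>y. R (\<lambda>i. if i < n then y i else (x(n := d)) i) f)" for x f
  proof
    assume "\<exists>y. R (\<lambda>i. if i < Suc n then y i else x i) f"
    then obtain y where "R (\<lambda>i. if i < Suc n then y i else x i) f" ..
    moreover have "(\<lambda>i. if i < Suc n then y i else x i) = (\<lambda>i. if i < n then y i else (x(n := y n)) i)"
      by (auto simp: fun_eq_iff less_Suc_eq)
    ultimately show "\<exists>d y. R (\<lambda>i. if i < n then y i else (x(n := d)) i) f" by metis
  next
    assume "\<exists>d y. R (\<lambda>i. if i < n then y i else (x(n := d)) i) f"
    then obtain d y where "R (\<lambda>i. if i < n then y i else (x(n := d)) i) f" by (elim exE)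
    moreover have "(\<lambda>i. if i < n then y i else (x(n := d)) i) =
        (\<lambda>i. if i < Suc n then (y(n := d)) i else x i)"
      by (auto simp: fun_eq_iff less_Suc_eq)
    ultimately show "\<exists>y. R (\<lambda>i. if i < Suc n then y i else x i) f" by metis
  qed
  then show ?case using dfn_ex[OF Suc.IH, of n] by (simp only:)
qed

lemma dfn_finite_support:
  assumes "dfn M B R"
  obtains n where "\<forall>x y f. (\<forall>i<n. x i = y i) \<longrightarrow> R x f = R y f"
proof -
  obtain \<psi> c where c: "range c \<subseteq> B" "\<forall>x f. R x f \<longleftrightarrow> psat UNIV M \<psi> (mix x (f \<circ> c))"
    using assms by (rule dfnE)
  obtain n where n: "\<forall>i\<in>fv \<psi>. i < n"
    using finite_fv finite_nat_set_iff_bounded by blast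
  have "R x f = R y f" if "\<forall>i<n. x i = y i" for x y f
    unfolding c(2)[rule_format]
  proof (rule psat_cong)
    fix i assume "i \<in> fv \<psi>"
    then have "i div 2 < n" using n by fastforce
    then show "mix x (f \<circ> c) i = mix y (f \<circ> c) i" using that by (simp add: mix_def)
  qed
  then show ?thesis by (intro that[of n]) simp
qed

text \<open>Quantifying over a whole sequence is first-order here, because a definable relation
  reads only finitely many places.\<close>

lemma dfn_ex_all:
  assumes "dfn M B R"
  shows "dfn M B (\<lambda>x f. \<exists>y. R y f)"
proof -
  obtain n where n: "\<forall>x y f. (\<forall>i<n. x i = y i) \<longrightarrow> R x f = R y f"
    using assms by (rule dfn_finite_support)
  have "R (\<lambda>i. if i < n then y i else x i) f = R y f" for x y f
    by (rule n[rule_format]) simp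
  then show ?thesis using dfn_ex_block[OF assms, of n] by (simp only:)
qed

text \<open>Place 0 stays free while the tail is quantified. Block quantification takes the places
  below \<open>n\<close>, so the free argument is parked at place \<open>n\<close> and fetched back
  by the renaming \<open>case_nat n id\<close>.\<close>

lemma dfn_ex_tail:
  assumes "dfn M B R"
  shows "dfn M B (\<lambda>x f. \<exists>y. R (case_nat (x 0) y) f)"
proof -
  obtain n where n: "\<forall>x y f. (\<forall>i<n. x i = y i) \<longrightarrow> R x f = R y f"
    using assms by (rule dfn_finite_support)
  have "dfn M B (\<lambda>x f. \<exists>y. R ((\<lambda>i. if i < n then y i else (x \<circ> (\<lambda>_. 0)) i) \<circ> case_nat n id) f)"
    by (rule dfn_ren[OF dfn_ex_block[OF dfn_ren[OF assms]]])
  moreover have "R ((\<lambda>i. if i < n then y i else (x \<circ> (\<lambda>_. 0)) i) \<circ> case_nat n id) f =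
      R (case_nat (x 0) y) f" for x y :: "nat \<Rightarrow> 'a" and f
    by (rule n[rule_format]) (auto split: nat.split)
  ultimately show ?thesis by (simp only:)
qed

lemma dfn_image:
  assumes "dfn M B R"
  shows "\<exists>R'. dfn M (f ` B) R' \<and> (\<forall>x. R' x id = R x f)"
proof -
  obtain \<psi> c where c: "range c \<subseteq> B" "\<forall>x f. R x f \<longleftrightarrow> psat UNIV M \<psi> (mix x (f \<circ> c))"
    using assms by (rule dfnE)
  have "dfn M (f ` B) (\<lambda>x g. R x (g \<circ> f))"
    using c(1) by (intro dfnI[of "f \<circ> c" _ _ M \<psi>]) (auto simp: c(2) comp_assoc)
  then show ?thesis by (intro exI[of _ "\<lambda>x g. R x (g \<circ> f)"]) simp
qed

lemma dfn_param_less: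
  assumes "m \<in> B"
  shows "dfn M B (\<lambda>x f. pless M (teval M L x) (f m))" "dfn M B (\<lambda>x f. pless M (f m) (teval M L x))"
proof -
  obtain k where k: "k \<notin> tvars L"
    using finite_tvars infinite_UNIV_nat by (metis ex_new_if_finite)
  define h where "h i = (if i = k then Inr m else Inl i)" for i
  have h: "teval M L (\<lambda>i. case h i of Inl j \<Rightarrow> x j | Inr m \<Rightarrow> f m) = teval M L x" for x f
    by (rule teval_cong) (use k in \<open>auto simp: h_def\<close>)
  have hk: "h k = Inr m" by (simp add: h_def)
  have "h i = Inr m' \<Longrightarrow> m' \<in> B" for i m' using assms by (auto simp: h_def split: if_splits)
  then show "dfn M B (\<lambda>x f. pless M (teval M L x) (f m))" "dfn M B (\<lambda>x f. pless M (f m) (teval M L x))"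
    using dfn_fm[OF assms, of "PLess L (PVar k)" h M] dfn_fm[OF assms, of "PLess (PVar k) L" h M]
    by (simp_all add: h hk)
qed

section \<open>Partial elementary maps and types\<close>

definition elem_map :: "'m pstruct \<Rightarrow> ('m \<Rightarrow> 'm) \<Rightarrow> 'm set \<Rightarrow> bool" where
  "elem_map M f B \<longleftrightarrow> (\<forall>\<psi> v. range v \<subseteq> B \<longrightarrow> psat UNIV M \<psi> v = psat UNIV M \<psi> (f \<circ> v))"

text \<open>\<open>f\<close> moves the arguments by composition and the parameters through the
  second argument of \<open>R\<close>.\<close>

lemma elem_map_dfn:
  assumes "elem_map M f B" "dfn M B R" "range x \<subseteq> B"
  shows "R x id = R (f \<circ> x) f"
proof -
  obtain \<psi> c where c: "range c \<subseteq> B" "\<forall>x f. R x f \<longleftrightarrow> psat UNIV M \<psi> (mix x (f \<circ> c))"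
    using assms(2) by (rule dfnE)
  have "range (mix x c) \<subseteq> B" using c(1) assms(3) by (auto simp: mix_def)
  then have "psat UNIV M \<psi> (mix x c) = psat UNIV M \<psi> (f \<circ> mix x c)"
    using assms(1) unfolding elem_map_def by (elim allE impE)
  then show ?thesis by (simp only: c(2) comp_mix id_comp)
qed

lemma elem_map_closed_dfn:
  assumes "elem_map M f B" "dfn M B (\<lambda>x. P)" "b \<in> B"
  shows "P id = P f"
  by (rule elem_map_dfn[OF assms(1,2), of "\<lambda>_. b"]) (use assms(3) in auto)

lemma elem_map_less:
  assumes "elem_map M f B" "a \<in> B" "b \<in> B"
  shows "pless M a b = pless M (f a) (f b)"
proof -
  have "range (\<lambda>i::nat. if i = 0 then a else b) \<subseteq> B" using assms by auto
  then have "psat UNIV M (PLess (PVar 0) (PVar 1)) (\<lambda>i. if i = 0 then a else b) =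
      psat UNIV M (PLess (PVar 0) (PVar 1)) (f \<circ> (\<lambda>i. if i = 0 then a else b))"
    using assms(1) unfolding elem_map_def by (elim allE impE)
  then show ?thesis by simp
qed

lemma elem_map_same_type:
  assumes f: "elem_map M f B" and fix': "\<And>m. m \<in> S \<Longrightarrow> f m = m" and B: "S \<subseteq> B" "set a \<subseteq> B"
  shows "same_type M S a (map f a)"
  unfolding same_type_def
proof (intro conjI allI impI)
  fix \<psi> and c :: "nat \<Rightarrow> 'a"
  assume c: "range c \<subseteq> S" and fv: "fv \<psi> \<subseteq> {i. odd i \<or> i div 2 < length a}"
  \<comment> \<open>Beyond \<open>length a\<close> the values of \<open>merge a c\<close> are
    unspecified and might leave \<open>B\<close>; they are replaced by \<open>c 0\<close>, which is
    harmless since \<psi> does not read them.\<close>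
  define v where "v i = (if odd i then c (i div 2) else if i div 2 < length a then a ! (i div 2) else c 0)" for i
  have cS: "c i \<in> S" for i using c by blast
  have "range v \<subseteq> B" using cS B by (auto simp: v_def)
  then have "psat UNIV M \<psi> v = psat UNIV M \<psi> (f \<circ> v)"
    using f unfolding elem_map_def by (elim allE impE)
  moreover have "psat UNIV M \<psi> v = psat UNIV M \<psi> (merge a c)"
    by (rule psat_cong) (use fv in \<open>auto simp: v_def merge_def\<close>)
  moreover have "psat UNIV M \<psi> (f \<circ> v) = psat UNIV M \<psi> (merge (map f a) c)"
    by (rule psat_cong) (use fv fix' cS in \<open>auto simp: v_def merge_def\<close>)
  ultimately show "psat UNIV M \<psi> (merge a c) = psat UNIV M \<psi> (merge (map f a) c)" by simp
qed simp

lemma same_type_refl: "same_type M S a a"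
  by (simp add: same_type_def)

lemma same_type_trans: "same_type M S a b \<Longrightarrow> same_type M S b c \<Longrightarrow> same_type M S a c"
  by (simp add: same_type_def)

text \<open>With \<open>x\<close> in \<open>S\<close>, the formula \<phi> at \<open>x\<close> is a
  formula over \<open>S\<close> in the tuple alone, hence decided by its type; \<open>\<rho>\<close>
  recodes the layout of \<open>asg\<close> into that of \<open>merge\<close>.\<close>

lemma same_type_psat_asg:
  assumes "same_type M S a b" "fv \<phi> \<subseteq> {..<n + length a}" "length x = n" "set x \<subseteq> S" "m \<in> S"
  shows "psat UNIV M \<phi> (asg n x a) = psat UNIV M \<phi> (asg n x b)"
proof -
  define \<rho> where "\<rho> i = (if i < n then 2 * i + 1 else 2 * (i - n))" for i
  define c where "c i = (if i < n then x ! i else m)" for i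
  from rename_fm[of \<rho> \<phi> UNIV M] obtain \<psi> where
    \<psi>: "fv \<psi> \<subseteq> \<rho> ` fv \<phi>" "\<forall>v. psat UNIV M \<psi> v = psat UNIV M \<phi> (v \<circ> \<rho>)" by (elim exE conjE)
  have merge: "merge y c \<circ> \<rho> = asg n x y" for y
    by (auto simp: merge_def \<rho>_def c_def asg_def fun_eq_iff)
  have "range c \<subseteq> S" using assms(3-5) by (auto simp: c_def)
  moreover have "fv \<psi> \<subseteq> {i. odd i \<or> i div 2 < length a}"
  proof
    fix j assume "j \<in> fv \<psi>"
    then obtain i where "i \<in> fv \<phi>" "j = \<rho> i" using \<psi>(1) by blast
    then show "j \<in> {i. odd i \<or> i div 2 < length a}" using assms(2) by (auto simp: \<rho>_def)
  qed
  ultimately have "psat UNIV M \<psi> (merge a c) = psat UNIV M \<psi> (merge b c)"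
    using assms(1) unfolding same_type_def by (elim conjE allE impE)
  then show ?thesis by (simp only: \<psi>(2) merge)
qed

section \<open>Saturation\<close>

abbreviation small :: "'m set \<Rightarrow> bool" where
  "small B \<equiv> (card_of B, card_of (UNIV :: 'm set)) \<in> ordLess"

lemma small_image:
  fixes f :: "'m \<Rightarrow> 'm"
  shows "small B \<Longrightarrow> small (f ` B)"
  by (rule ordLeq_ordLess_trans[OF card_of_image])

lemma (in pres) small_Un_finite:
  assumes "small B" "finite (D :: 'm set)"
  shows "small (B \<union> D)"
proof -
  have "small D"
  proof (rule ccontr)
    assume "\<not> small D"
    then have "(card_of (UNIV :: 'm set), card_of D) \<in> ordLeq"
      using ordLess_or_ordLeq[OF card_of_Well_order card_of_Well_order] by blast
    from card_of_ordLeq_finite[OF this assms(2)] show False using infinite_UNIV_M by simp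
  qed
  then show ?thesis by (rule card_of_Un_ordLess_infinite[OF infinite_UNIV_M assms(1)])
qed

text \<open>Saturation restated for predicates: a unary predicate over \<open>B\<close> is a
  definable relation evaluated at constant sequences, so the conditions to be realised can be built
  with the \<open>dfn\<close> rules.\<close>

lemma saturatedD:
  fixes M :: "'m pstruct"
  assumes sat: "saturated M" and small: "small B"
    and \<Q>: "\<And>Q. Q \<in> \<Q> \<Longrightarrow> \<exists>R. dfn M B R \<and> Q = (\<lambda>b. R (\<lambda>_. b) id)"
    and fin: "\<And>F. finite F \<Longrightarrow> F \<subseteq> \<Q> \<Longrightarrow> \<exists>b. \<forall>Q\<in>F. Q b"
  shows "\<exists>b. \<forall>Q\<in>\<Q>. Q b"
proof -
  define q where "q = (\<lambda>(\<psi>, w) b. psat UNIV M \<psi> (w(0 := b)))"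
  define \<Sigma> where "\<Sigma> = {(\<psi>, w). range w \<subseteq> B \<and> q (\<psi>, w) \<in> \<Q>}"
  have lift: "\<exists>s\<in>\<Sigma>. q s = Q" if Q: "Q \<in> \<Q>" for Q
  proof -
    obtain R where R: "dfn M B R" "Q = (\<lambda>b. R (\<lambda>_. b) id)" using \<Q>[OF Q] by (elim exE conjE)
    obtain \<psi> c where c: "range c \<subseteq> B" "\<forall>x f. R x f \<longleftrightarrow> psat UNIV M \<psi> (mix x (f \<circ> c))"
      using R(1) by (rule dfnE)
    \<comment> \<open>All arguments collapse to variable 0, the element to be realised, and the
      parameters are shifted by one to make room for it.\<close>
    define \<rho> where "\<rho> i = (if even i then 0 else Suc (i div 2))" for i :: nat
    define w where "w i = c (i - 1)" for i
    from rename_fm[of \<rho> \<psi> UNIV M] obtain \<psi>' where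
      \<psi>': "\<forall>v. psat UNIV M \<psi>' v = psat UNIV M \<psi> (v \<circ> \<rho>)" by (elim exE conjE)
    have "w(0 := b) \<circ> \<rho> = mix (\<lambda>_. b) c" for b
      by (auto simp: w_def \<rho>_def mix_def fun_eq_iff)
    then have "q (\<psi>', w) = Q"
      by (simp add: q_def R(2) c(2) \<psi>')
    moreover have "range w \<subseteq> B" using c(1) by (auto simp: w_def)
    ultimately show ?thesis using Q by (intro bexI[of _ "(\<psi>', w)"]) (simp_all add: \<Sigma>_def)
  qed
  have "\<exists>b. \<forall>s\<in>\<Sigma>. q s b"
  proof -
    have 1: "\<forall>(\<psi>, w)\<in>\<Sigma>. range w \<subseteq> B" by (auto simp: \<Sigma>_def)
    have 2: "\<forall>F. finite F \<longrightarrow> F \<subseteq> \<Sigma> \<longrightarrow> (\<exists>b. \<forall>(\<psi>, w)\<in>F. psat UNIV M \<psi> (w(0 := b)))"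
    proof (intro allI impI)
      fix F assume F: "finite F" "F \<subseteq> \<Sigma>"
      then have "\<exists>b. \<forall>Q\<in>q ` F. Q b" by (intro fin) (auto simp: \<Sigma>_def)
      then show "\<exists>b. \<forall>(\<psi>, w)\<in>F. psat UNIV M \<psi> (w(0 := b))"
        by (simp add: q_def case_prod_beta)
    qed
    have "\<exists>b. \<forall>(\<psi>, w)\<in>\<Sigma>. psat UNIV M \<psi> (w(0 := b))"
      using sat[unfolded saturated_def, THEN spec, THEN spec, THEN mp, THEN mp, THEN mp, OF small 1 2] .
    then show ?thesis by (simp add: q_def case_prod_beta)
  qed
  then obtain b where b: "\<forall>s\<in>\<Sigma>. q s b" ..
  have "Q b" if "Q \<in> \<Q>" for Q
    using lift[OF that]
  proof
    fix s assume "s \<in> \<Sigma>" "q s = Q"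
    then show "Q b" using bspec[OF b, of s] by simp
  qed
  then show ?thesis by (intro exI[of _ b] ballI)
qed

lemma dfn_ex_diag:
  assumes "dfn M B R"
  shows "dfn M B (\<lambda>x f. \<exists>d. R (\<lambda>_. d) f)"
proof -
  have "dfn M B (\<lambda>x f. \<exists>d. R (x(0 := d) \<circ> (\<lambda>_. 0)) f)"
    by (rule dfn_ex[OF dfn_ren[OF assms]])
  moreover have "x(0 := d) \<circ> (\<lambda>_ :: nat. 0) = (\<lambda>_. d)" for x :: "nat \<Rightarrow> 'a" and d
    by auto
  ultimately show ?thesis by (simp only:)
qed

text \<open>\<open>real\<close> says that \<open>d'\<close> realises the image under
  \<open>f\<close> of the type of \<open>d\<close> over \<open>B\<close>. One implication suffices,
  since a type contains every relation or its negation.\<close>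

lemma elem_map_insert:
  assumes "b0 \<in> B" "d \<notin> B" and real: "\<And>R. dfn M B R \<Longrightarrow> R (\<lambda>_. d) id \<Longrightarrow> R (\<lambda>_. d') f"
  shows "elem_map M (f(d := d')) (insert d B)"
  unfolding elem_map_def
proof (intro allI impI)
  fix \<psi> and v :: "nat \<Rightarrow> 'a"
  assume v: "range v \<subseteq> insert d B"
  define h where "h i = (if v i = d then Inl i else Inr (v i))" for i
  define R where "R = (\<lambda>x f. psat UNIV M \<psi> (\<lambda>i. case h i of Inl j \<Rightarrow> x j | Inr m \<Rightarrow> f m))"
  have "m \<in> B" if "h i = Inr m" for i m
    using v that by (auto simp: h_def split: if_splits)
  then have R: "dfn M B R" unfolding R_def using assms(1) by (intro dfn_fm) simp_all
  have "(\<lambda>i. case h i of Inl j \<Rightarrow> d | Inr m \<Rightarrow> id m) = v" by (auto simp: h_def)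
  then have "R (\<lambda>_. d) id = psat UNIV M \<psi> v" by (simp only: R_def)
  moreover have "(\<lambda>i. case h i of Inl j \<Rightarrow> d' | Inr m \<Rightarrow> f m) = f(d := d') \<circ> v"
    by (auto simp: h_def)
  then have "R (\<lambda>_. d') f = psat UNIV M \<psi> (f(d := d') \<circ> v)" by (simp only: R_def)
  moreover have "R (\<lambda>_. d) id = R (\<lambda>_. d') f"
    using real[OF R] real[OF dfn_not[OF R]] by blast
  ultimately show "psat UNIV M \<psi> v = psat UNIV M \<psi> (f(d := d') \<circ> v)" by simp
qed

text \<open>The image under \<open>f\<close> of the type of \<open>d\<close> over \<open>B\<close>
  is finitely satisfiable: that a finite conjunction has a solution is a closed statement, which
  \<open>f\<close> preserves. Its parameters lie in the image of \<open>B\<close>, which is small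
  too.\<close>

lemma elem_map_extend1:
  fixes M :: "'m pstruct"
  assumes sat: "saturated M" and f: "elem_map M f B" and B: "small B" "b0 \<in> B"
  shows "\<exists>f'. elem_map M f' (insert d B) \<and> (\<forall>b\<in>B. f' b = f b)"
proof (cases "d \<in> B")
  case True
  then show ?thesis using f by (intro exI[of _ f]) (simp add: insert_absorb)
next
  case False
  define \<R> where "\<R> = {R. dfn M B R \<and> R (\<lambda>_. d) id}"
  have "\<exists>b. \<forall>Q\<in>(\<lambda>R b. R (\<lambda>_. b) f) ` \<R>. Q b"
  proof (rule saturatedD[OF sat small_image[OF B(1)]])
    fix Q assume "Q \<in> (\<lambda>R b. R (\<lambda>_. b) f) ` \<R>"
    then obtain R where R: "dfn M B R" "Q = (\<lambda>b. R (\<lambda>_. b) f)" by (auto simp: \<R>_def)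
    from dfn_image[OF R(1), of f] show "\<exists>R. dfn M (f ` B) R \<and> Q = (\<lambda>b. R (\<lambda>_. b) id)"
    proof (elim exE conjE)
      fix R' assume "dfn M (f ` B) R'" "\<forall>x. R' x id = R x f"
      then show ?thesis using R(2) by (intro exI[of _ R']) simp
    qed
  next
    fix F assume "finite F" "F \<subseteq> (\<lambda>R b. R (\<lambda>_. b) f) ` \<R>"
    from finite_subset_image[OF this] obtain G where
      G: "G \<subseteq> \<R>" "finite G" "F = (\<lambda>R b. R (\<lambda>_. b) f) ` G"
      by (elim exE conjE) (rule that)
    have "dfn M B (\<lambda>x f. \<forall>R\<in>G. R x f)"
      using G by (intro dfn_Ball[OF B(2)]) (auto simp: \<R>_def)
    from elem_map_closed_dfn[OF f dfn_ex_diag[OF this] B(2)]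
    have "\<exists>b. \<forall>R\<in>G. R (\<lambda>_. b) f" using G(1) by (auto simp: \<R>_def)
    then show "\<exists>b. \<forall>Q\<in>F. Q b" using G(3) by simp
  qed
  then obtain d' where d': "\<forall>R\<in>\<R>. R (\<lambda>_. d') f" by auto
  have "elem_map M (f(d := d')) (insert d B)"
  proof (rule elem_map_insert[OF B(2) False])
    fix R assume "dfn M B R" "R (\<lambda>_. d) id"
    then show "R (\<lambda>_. d') f" using bspec[OF d', of R] by (simp add: \<R>_def)
  qed
  then show ?thesis using False by (intro exI[of _ "f(d := d')"]) auto
qed

lemma (in pres) elem_map_extend:
  assumes sat: "saturated M" and f: "elem_map M f B" and B: "small B" "b0 \<in> B" and "finite D"
  shows "\<exists>f'. elem_map M f' (B \<union> D) \<and> (\<forall>b\<in>B. f' b = f b)"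
  using \<open>finite D\<close>
proof (induction D)
  case empty
  then show ?case using f by auto
next
  case (insert d D)
  then obtain f1 where f1: "elem_map M f1 (B \<union> D)" "\<forall>b\<in>B. f1 b = f b" by (elim exE conjE) 
  have "b0 \<in> B \<union> D" using B by simp
  from elem_map_extend1[OF sat f1(1) small_Un_finite[OF B(1) insert.hyps(1)] this, of d]
  obtain f' where "elem_map M f' (insert d (B \<union> D))" "\<forall>b\<in>B \<union> D. f' b = f1 b"
    by (elim exE conjE)
  then show ?case using f1(2) by (intro exI[of _ f']) simp
qed

section \<open>Elementary submodels and strips\<close>

locale pres_sub = pres M for M :: "'m pstruct" +
  fixes M0 :: "'m set"
  assumes sat: "saturated M" and sub: "elem_sub M0 M" and small_sub: "small M0"
begin

lemma zero_in_sub: "pzero M \<in> M0"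
  using sub by (simp add: elem_sub_def)

lemma sub_psat: "range v \<subseteq> M0 \<Longrightarrow> psat M0 M \<phi> v = psat UNIV M \<phi> v"
  using sub unfolding elem_sub_def by blast

text \<open>The Tarski-Vaught property: the existential statement passes from \<open>M\<close> to
  \<open>M0\<close> by elementarity, and the witness found there is good in \<open>M\<close> for the
  same reason.\<close>

lemma sub_witness:
  assumes R: "dfn M M0 R" and x: "range x \<subseteq> M0" and "R (x(k := d)) id"
  shows "\<exists>d\<in>M0. R (x(k := d)) id"
proof -
  obtain \<psi> c where c: "range c \<subseteq> M0" "\<forall>x f. R x f \<longleftrightarrow> psat UNIV M \<psi> (mix x (f \<circ> c))"
    using R by (rule dfnE)
  have mix: "range (mix y c) \<subseteq> M0" if "range y \<subseteq> M0" for y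
    using that c(1) by (auto simp: mix_def)
  have "psat UNIV M (PEx (2 * k) \<psi>) (mix x c)"
    using assms(3) by (auto simp: mix_upd c(2))
  then have "psat M0 M (PEx (2 * k) \<psi>) (mix x c)"
    by (simp only: sub_psat[OF mix[OF x]])
  then obtain d where d: "d \<in> M0" "psat M0 M \<psi> (mix (x(k := d)) c)"
    by (auto simp: mix_upd)
  have "range (x(k := d)) \<subseteq> M0" using x d(1) by auto
  then have "R (x(k := d)) id"
    using d(2) by (simp add: sub_psat[OF mix] c(2))
  then show ?thesis using d(1) by blast
qed

text \<open>By finite support all but finitely many coordinates may be set to 0. The last remaining
  one is quantified away, the induction moves the others into \<open>M0\<close>, and
  \<open>sub_witness\<close> then supplies the last.\<close>

lemma sub_exists:
  assumes R: "dfn M M0 R" and "R x id"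
  shows "\<exists>y. range y \<subseteq> M0 \<and> R y id"
proof -
  let ?z = "pzero M"
  have step: "\<exists>y. range y \<subseteq> M0 \<and> R y id"
    if "dfn M M0 R" "\<forall>i\<ge>n. x i = ?z" "R x id" for n R x
    using that
  proof (induction n arbitrary: R x)
    case 0
    then have "range x \<subseteq> M0" using zero_in_sub by auto
    then show ?case using 0(3) by blast
  next
    case (Suc n)
    have "(x(n := ?z))(n := x n) = x" by simp
    then have "\<exists>d. R ((x(n := ?z))(n := d)) id" using Suc.prems(3) by metis
    moreover have "\<forall>i\<ge>n. (x(n := ?z)) i = ?z" using Suc.prems(2) by (simp add: Suc_le_eq)
    ultimately have "\<exists>y. range y \<subseteq> M0 \<and> (\<exists>d. R (y(n := d)) id)"
      by (intro Suc.IH[OF dfn_ex[OF Suc.prems(1), of n]])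
    then obtain y where y: "range y \<subseteq> M0" "\<exists>d. R (y(n := d)) id" by blast
    from y(2) obtain d where "R (y(n := d)) id" ..
    from sub_witness[OF Suc.prems(1) y(1) this] obtain e where e: "e \<in> M0" "R (y(n := e)) id" ..
    then have "range (y(n := e)) \<subseteq> M0" using y(1) by auto
    then show ?case using e(2) by (intro exI conjI)
  qed
  obtain n where n: "\<forall>x y f. (\<forall>i<n. x i = y i) \<longrightarrow> R x f = R y f"
    using R by (rule dfn_finite_support)
  have "R (\<lambda>i. if i < n then x i else ?z) id = R x id"
    by (rule n[rule_format]) simp
  then show ?thesis
    using step[OF R, of n "\<lambda>i. if i < n then x i else ?z"] assms(2) by simp
qed

text \<open>The maximum exists in \<open>M\<close> by \<open>psat_max\<close>. Being a maximum is
  again definable over \<open>M0\<close>, by \<open>G\<close>, so elementarity provides one in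
  \<open>M0\<close>.\<close>

lemma sub_max:
  assumes R: "dfn M M0 R" and l: "R (\<lambda>_. l) id" and u: "\<And>d. R (\<lambda>_. d) id \<Longrightarrow> d \<preceq> u"
  shows "\<exists>g\<in>M0. l \<preceq> g \<and> g \<preceq> u"
proof -
  have S: "dfn M M0 (\<lambda>x f. R (x \<circ> (\<lambda>_. 0)) f)" by (rule dfn_ren[OF R])
  obtain \<psi> c where c: "range c \<subseteq> M0"
    "\<forall>x f. R (x \<circ> (\<lambda>_. 0)) f \<longleftrightarrow> psat UNIV M \<psi> (mix x (f \<circ> c))"
    using S by (rule dfnE)
  let ?x = "\<lambda>_ :: nat. pzero M"
  have const: "x(0 := d) \<circ> (\<lambda>_ :: nat. 0) = (\<lambda>_. d)" for x :: "nat \<Rightarrow> 'm" and d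
    by auto
  have "psat UNIV M \<psi> ((mix ?x c)(0 := d)) = R (\<lambda>_. d) id" for d
    using mix_upd[of ?x c 0 d] c(2)[rule_format, of "?x(0 := d)" id] const[of ?x d] by simp
  then obtain g where g: "R (\<lambda>_. g) id" "\<forall>d. R (\<lambda>_. d) id \<longrightarrow> d \<preceq> g"
    using psat_max[of \<psi> "mix ?x c" 0 l u] l u by auto
  \<comment> \<open>\<open>x 0\<close> is the proposed maximum and \<open>x 1\<close> a larger
    element of the set.\<close>
  define G where "G = (\<lambda>x f. R (x \<circ> (\<lambda>_. 0)) f \<and>
    \<not> (\<exists>d. R (x(1 := d) \<circ> (\<lambda>_. 1)) f \<and> psat UNIV M (PLess (PVar 0) (PVar 1)) (x(1 := d))))"
  have "dfn M M0 G"
    unfolding G_def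
    by (intro dfn_conj S dfn_not
        dfn_ex[of M M0 "\<lambda>x f. R (x \<circ> (\<lambda>_. 1)) f \<and> psat UNIV M (PLess (PVar 0) (PVar 1)) x"]
        dfn_ren[OF R] dfn_psat[OF zero_in_sub])
  moreover have one: "x(1 := d) \<circ> (\<lambda>_ :: nat. 1) = (\<lambda>_. d)" for x :: "nat \<Rightarrow> 'm" and d
    by auto
  have G: "G (?x(0 := g)) id \<longleftrightarrow> R (\<lambda>_. g) id \<and> (\<forall>d. R (\<lambda>_. d) id \<longrightarrow> d \<preceq> g)" for g
    unfolding G_def const one by auto
  moreover have "G (?x(0 := g)) id" using g by (simp only: G)
  moreover have "range ?x \<subseteq> M0" using zero_in_sub by auto
  ultimately obtain e where "e \<in> M0" "G (?x(0 := e)) id"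
    using sub_witness by metis
  then show ?thesis using l u unfolding G by blast
qed

section \<open>Strips and their conjugates\<close>

text \<open>Equivalently, \<open>l <= u\<close> are elements outside \<open>M0\<close> that
  determine the same cut of \<open>M0\<close>.\<close>

definition missing :: "'m \<Rightarrow> 'm \<Rightarrow> bool" where
  "missing l u \<longleftrightarrow> l \<preceq> u \<and> (\<forall>m\<in>M0. m \<prec> l \<or> u \<prec> m)"

lemma missing_elem_map:
  assumes "elem_map M f B" "M0 \<subseteq> B" "l \<in> B" "u \<in> B" "\<forall>m\<in>M0. f m = m" "missing l u"
  shows "missing (f l) (f u)"
  unfolding missing_def
proof (intro conjI ballI)
  show "f l \<preceq> f u"
    using assms(6) elem_map_less[OF assms(1), of u l] assms(3,4) by (simp add: missing_def)
  fix m assume m: "m \<in> M0"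
  then have "m \<prec> l \<or> u \<prec> m" using assms(6) by (simp add: missing_def)
  then show "m \<prec> f l \<or> f u \<prec> m"
    using elem_map_less[OF assms(1), of m l] elem_map_less[OF assms(1), of u m] m assms(2-5) by auto
qed

text \<open>An \<open>M0\<close>-definable set containing \<open>l\<close> is not bounded by \<open>u\<close>: otherwise its maximum would be
  an element of \<open>M0\<close> in the interval \<open>[l, u]\<close>.\<close>
lemma conjugate_above:
  assumes miss: "missing l u" and D: "finite D"
  shows "\<exists>f. elem_map M f (insert l M0 \<union> D) \<and> (\<forall>m\<in>M0. f m = m) \<and> u \<prec> f l"
proof -
  have l: "l \<notin> M0" using miss less_irrefl by (auto simp: missing_def)
  define \<R> where "\<R> = {R. dfn M M0 R \<and> R (\<lambda>_. l) id}"
  have "\<exists>b. \<forall>Q\<in>insert (\<lambda>b. u \<prec> b) ((\<lambda>R b. R (\<lambda>_. b) id) ` \<R>). Q b"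
  proof (rule saturatedD[OF sat])
    show "small (M0 \<union> {u})" by (rule small_Un_finite[OF small_sub]) simp
  next
    fix Q assume "Q \<in> insert (\<lambda>b. u \<prec> b) ((\<lambda>R b. R (\<lambda>_. b) id) ` \<R>)"
    then consider "Q = (\<lambda>b. u \<prec> b)" | R where "dfn M M0 R" "Q = (\<lambda>b. R (\<lambda>_. b) id)"
      by (auto simp: \<R>_def)
    then show "\<exists>R. dfn M (M0 \<union> {u}) R \<and> Q = (\<lambda>b. R (\<lambda>_. b) id)"
    proof cases
      case 1
      show ?thesis
        using dfn_param_less(2)[of u "M0 \<union> {u}" M "PVar 0"] 1
        by (intro exI[of _ "\<lambda>x f. f u \<prec> teval M (PVar 0) x"]) simp
    next
      case (2 R)
      show ?thesis using dfn_mono[OF 2(1) Un_upper1] 2(2) by (intro exI[of _ R] conjI)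
    qed
  next
    fix F assume F: "finite F" "F \<subseteq> insert (\<lambda>b. u \<prec> b) ((\<lambda>R b. R (\<lambda>_. b) id) ` \<R>)"
    then have "finite (F - {\<lambda>b. u \<prec> b})" "F - {\<lambda>b. u \<prec> b} \<subseteq> (\<lambda>R b. R (\<lambda>_. b) id) ` \<R>"
      by auto
    from finite_subset_image[OF this] obtain G where
      G: "G \<subseteq> \<R>" "finite G" "F - {\<lambda>b. u \<prec> b} = (\<lambda>R b. R (\<lambda>_. b) id) ` G"
      by (elim exE conjE) (rule that)
    have "dfn M M0 (\<lambda>x f. \<forall>R\<in>G. R x f)"
      using G by (intro dfn_Ball[OF zero_in_sub]) (auto simp: \<R>_def)
    moreover have "\<forall>R\<in>G. R (\<lambda>_. l) id" using G(1) by (auto simp: \<R>_def)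
    ultimately have "\<not> (\<forall>d. (\<forall>R\<in>G. R (\<lambda>_. d) id) \<longrightarrow> d \<preceq> u)"
      using sub_max[of "\<lambda>x f. \<forall>R\<in>G. R x f" l u] miss unfolding missing_def by blast
    then obtain b where b: "\<forall>R\<in>G. R (\<lambda>_. b) id" "u \<prec> b" by blast
    have "Q b" if "Q \<in> F" for Q
    proof (cases "Q = (\<lambda>b. u \<prec> b)")
      case True
      then show ?thesis using b(2) by simp
    next
      case False
      then have "Q \<in> (\<lambda>R b. R (\<lambda>_. b) id) ` G" using that G(3) by blast
      then show ?thesis using b(1) by auto
    qed
    then show "\<exists>b. \<forall>Q\<in>F. Q b" by (intro exI[of _ b] ballI)
  qed
  then obtain b where b: "u \<prec> b" "\<forall>R\<in>\<R>. R (\<lambda>_. b) id" by auto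
  have *: "elem_map M (id(l := b)) (insert l M0)"
  proof (rule elem_map_insert[OF zero_in_sub l])
    fix R assume "dfn M M0 R" "R (\<lambda>_. l) id"
    then show "R (\<lambda>_. b) id" using bspec[OF b(2), of R] by (simp add: \<R>_def)
  qed
  have "small (insert l M0)" using small_Un_finite[OF small_sub, of "{l}"] by simp
  \<comment> \<open>The map sending \<open>l\<close> to its conjugate \<open>b\<close> above
    \<open>u\<close> is extended to \<open>D\<close>, so that other strip ends and whole tuples can
    be moved along with \<open>l\<close>.\<close>
  from elem_map_extend[OF sat * this _ D, of l]
  obtain f where f: "elem_map M f (insert l M0 \<union> D)" "\<forall>x\<in>insert l M0. f x = (id(l := b)) x"
    by auto
  have "\<forall>m\<in>M0. f m = m" using f(2) l by auto
  moreover have "u \<prec> f l" using f(2) b(1) by simp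
  ultimately show ?thesis using f(1) by (intro exI[of _ f] conjI)
qed

definition strip_fm :: "ptm \<Rightarrow> nat \<Rightarrow> pfm" where
  "strip_fm L n = PAnd (PNot (PLess L (PVar n))) (PNot (PLess (PVar (Suc n)) L))"

fun in_strip :: "(nat \<Rightarrow> 'm) \<Rightarrow> ptm \<times> 'm \<times> 'm \<Rightarrow> bool" where
  "in_strip x (L, l, u) \<longleftrightarrow> l \<preceq> teval M L x \<and> teval M L x \<preceq> u"

fun good_strip :: "nat \<Rightarrow> ptm \<times> 'm \<times> 'm \<Rightarrow> bool" where
  "good_strip n (L, l, u) \<longleftrightarrow> tvars L \<subseteq> {..<n} \<and> missing l u"

lemma psat_strip_fm:
  assumes "tvars L \<subseteq> {..<n}"
  shows "psat UNIV M (strip_fm L n) (asg n x [l, u]) \<longleftrightarrow> in_strip (nth x) (L, l, u)"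
proof -
  have "teval M L (asg n x [l, u]) = teval M L (nth x)"
    by (rule teval_cong) (use assms in \<open>auto simp: asg_def\<close>)
  then show ?thesis by (simp add: strip_fm_def asg_def)
qed

text \<open>The image of a missing interval under an elementary map over \<open>M0\<close> is
  missing and has the same type, so \<open>conjugate_above\<close> applies to it anew. Iteration
  gives intervals each above the one before; \<open>L x\<close> cannot lie in two of them, so the
  conjugates are 2-inconsistent.\<close>

lemma strip_divides:
  assumes L: "tvars L \<subseteq> {..<n}" and lu: "missing l u"
  shows "divides M M0 n (strip_fm L n) [l, u]"
proof -
  define P where "P p \<longleftrightarrow> missing (fst p) (snd p) \<and> same_type M M0 [l, u] [fst p, snd p]" for p
  have "\<exists>s. \<forall>i. P (s i) \<and> snd (s i) \<prec> fst (s (Suc i))"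
  proof (rule dependent_nat_choice)
    show "\<exists>p. P p" using lu by (intro exI[of _ "(l, u)"]) (simp add: P_def same_type_refl)
  next
    fix p i assume "P p"
    then have p: "missing (fst p) (snd p)" "same_type M M0 [l, u] [fst p, snd p]"
      by (simp_all add: P_def)
    \<comment> \<open>The upper end is put into the domain of \<open>f\<close> so that the whole
      interval is moved.\<close>
    from conjugate_above[OF p(1), of "{snd p}"] obtain f where
      f: "elem_map M f (insert (fst p) M0 \<union> {snd p})" "\<forall>m\<in>M0. f m = m" "snd p \<prec> f (fst p)"
      by auto
    have "missing (f (fst p)) (f (snd p))"
      by (rule missing_elem_map[OF f(1) _ _ _ f(2) p(1)]) auto
    moreover have "same_type M M0 [fst p, snd p] (map f [fst p, snd p])"
      by (rule elem_map_same_type[OF f(1)]) (use f(2) in auto)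
    then have "same_type M M0 [l, u] [f (fst p), f (snd p)]"
      using same_type_trans[OF p(2)] by simp
    ultimately show "\<exists>q. P q \<and> snd p \<prec> fst q"
      using f(3) by (intro exI[of _ "(f (fst p), f (snd p))"]) (simp add: P_def)
  qed
  then obtain s where "\<forall>i. P (s i) \<and> snd (s i) \<prec> fst (s (Suc i))" ..
  then have s: "\<forall>i. P (s i)" "\<forall>i. snd (s i) \<prec> fst (s (Suc i))" by simp_all
  have ord: "snd (s i) \<prec> fst (s j)" if "i < j" for i j
    using that
  proof (induction j)
    case (Suc j)
    show ?case
    proof (cases "i = j")
      case True
      then show ?thesis using s(2) by simp
    next
      case False
      then have "snd (s i) \<prec> fst (s j)" using Suc by simp
      moreover have "fst (s j) \<preceq> snd (s j)" using s(1) by (simp add: P_def missing_def)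
      moreover have "snd (s j) \<prec> fst (s (Suc j))" using s(2) by simp
      ultimately show ?thesis by (meson ord.less_le_trans less_trans)
    qed
  qed simp
  have disj: "\<not> (in_strip x (L, s i) \<and> in_strip x (L, s j))" if "i < j" for x i j
  proof
    assume "in_strip x (L, s i) \<and> in_strip x (L, s j)"
    then have "teval M L x \<preceq> snd (s i)" "fst (s j) \<preceq> teval M L x"
      by (cases "s i"; cases "s j"; simp)+
    with ord[OF that] show False by (meson ord.le_less_trans)
  qed
  show ?thesis
    unfolding divides_def
  proof (intro exI[of _ "\<lambda>i. [fst (s i), snd (s i)]"] exI[of _ 2] conjI allI impI)
    show "same_type M M0 [l, u] [fst (s i), snd (s i)]" for i
      using s(1) by (simp add: P_def)
    fix I :: "nat set" assume I: "finite I" "card I = 2"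
    then obtain i j where ij: "I = {i, j}" "i \<noteq> j" by (auto simp: card_2_iff)
    have "\<not> (in_strip x (L, s i) \<and> in_strip x (L, s j))" for x
      using disj[of i j x] disj[of j i x] ij(2) by (cases "i < j") auto
    then show "\<not> (\<exists>x. length x = n \<and> (\<forall>i\<in>I. psat UNIV M (strip_fm L n) (asg n x [fst (s i), snd (s i)])))"
      unfolding psat_strip_fm[OF L] using ij(1) by simp
  qed simp
qed

section \<open>Covering by strips\<close>

text \<open>If \<open>t\<close> is not in \<open>M0\<close>, the bound \<open>L x \<preceq> t\<close> can be sharpened to \<open>L x \<prec> t'\<close>, where \<open>t'\<close> lies in
  the same cut of \<open>M0\<close> as \<open>t\<close>, at the cost of one strip. Saturation provides a \<open>t'\<close> which is so
  small that the remaining set behaves as if \<open>t'\<close> were an element of \<open>M0\<close> below \<open>t\<close>.\<close>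
lemma cover:
  assumes "finite P" "M0 \<subseteq> B" "small B" "dfn M B R"
    and "\<forall>p\<in>P. tvars (fst p) \<subseteq> {..<n} \<and> (\<exists>m\<in>M0. m \<preceq> snd p)"
    and "\<forall>h. (\<forall>p\<in>P. h p \<in> M0 \<and> h p \<preceq> snd p) \<longrightarrow>
      \<not> (\<exists>x. R x id \<and> (\<forall>p\<in>P. teval M (fst p) x \<preceq> h p))"
  shows "\<exists>st. (\<forall>s\<in>set st. good_strip n s) \<and>
    (\<forall>x. R x id \<and> (\<forall>p\<in>P. teval M (fst p) x \<preceq> snd p) \<longrightarrow> (\<exists>s\<in>set st. in_strip x s))"
  using assms
proof (induction P arbitrary: B R)
  case empty
  then show ?case by (intro exI[of _ "[]"]) simp
next
  case (insert p P)
  note MB = insert.prems(1) and smallB = insert.prems(2) and dR = insert.prems(3)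
  obtain L t where p: "p = (L, t)" by (cases p)
  have L: "tvars L \<subseteq> {..<n}" "\<exists>m\<in>M0. m \<preceq> t"
    and P: "\<forall>p\<in>P. tvars (fst p) \<subseteq> {..<n} \<and> (\<exists>m\<in>M0. m \<preceq> snd p)"
    using insert.prems(4) by (simp_all add: p)
  have empty: "\<not> (R x id \<and> teval M L x \<preceq> m \<and> (\<forall>q\<in>P. teval M (fst q) x \<preceq> h q))"
    if "m \<in> M0" "m \<preceq> t" "\<forall>q\<in>P. h q \<in> M0 \<and> h q \<preceq> snd q" for h m x
  proof -
    have "\<forall>q\<in>insert p P. (h(p := m)) q \<in> M0 \<and> (h(p := m)) q \<preceq> snd q"
      using that by (simp add: p)
    from insert.prems(5)[THEN spec, THEN mp, OF this, unfolded not_ex, THEN spec, of x]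
    have "\<not> (R x id \<and> (\<forall>q\<in>insert p P. teval M (fst q) x \<preceq> (h(p := m)) q))" .
    moreover have "(\<forall>q\<in>insert p P. teval M (fst q) x \<preceq> (h(p := m)) q) \<longleftrightarrow>
        teval M L x \<preceq> m \<and> (\<forall>q\<in>P. teval M (fst q) x \<preceq> h q)"
      using insert.hyps(2) by (auto simp: p)
    ultimately show ?thesis by (simp only: simp_thms)
  qed
  show ?case
  proof (cases "t \<in> M0")
    case True
    \<comment> \<open>A bound in \<open>M0\<close> is itself an admissible value of
      \<open>h\<close>, so its inequality can be absorbed into the relation at no cost.\<close>
    define R' where "R' = (\<lambda>x f. R x f \<and> teval M L x \<preceq> f t)"
    have "dfn M B R'"
      unfolding R'_def using True MB by (intro dfn_conj dR dfn_not dfn_param_less) blast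
    moreover have "\<forall>h. (\<forall>p\<in>P. h p \<in> M0 \<and> h p \<preceq> snd p) \<longrightarrow>
      \<not> (\<exists>x. R' x id \<and> (\<forall>p\<in>P. teval M (fst p) x \<preceq> h p))"
      using empty[OF True less_irrefl] by (simp add: R'_def)
    ultimately have "\<exists>st. (\<forall>s\<in>set st. good_strip n s) \<and>
      (\<forall>x. R' x id \<and> (\<forall>p\<in>P. teval M (fst p) x \<preceq> snd p) \<longrightarrow> (\<exists>s\<in>set st. in_strip x s))"
      by (intro insert.IH[OF MB smallB _ P])
    then obtain st where st: "\<forall>s\<in>set st. good_strip n s"
      "\<forall>x. R' x id \<and> (\<forall>p\<in>P. teval M (fst p) x \<preceq> snd p) \<longrightarrow> (\<exists>s\<in>set st. in_strip x s)"
      by (elim exE conjE)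
    show ?thesis
    proof (intro exI[of _ st] conjI allI impI st(1))
      fix x assume "R x id \<and> (\<forall>p\<in>insert p P. teval M (fst p) x \<preceq> snd p)"
      then have "R' x id \<and> (\<forall>p\<in>P. teval M (fst p) x \<preceq> snd p)" by (simp add: R'_def p)
      then show "\<exists>s\<in>set st. in_strip x s" by (rule st(2)[THEN spec, THEN mp])
    qed
  next
    case False
    \<comment> \<open>\<open>V\<close> collects the bounds from \<open>M0\<close> allowed for the
      other inequalities, and \<open>Qh h b\<close> says that these together with
      \<open>L x < b\<close> are inconsistent on \<open>R\<close>. Requiring \<open>Qh h t'\<close>
      for every \<open>h\<close> in \<open>V\<close> is the induction hypothesis for
      \<open>R\<close> cut down to \<open>L x < t'\<close>; the remaining conditions in
      \<open>\<Q>\<close> make the interval from \<open>t'\<close> to \<open>t\<close> miss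
      \<open>M0\<close>.\<close>
    define V where "V = {h. \<forall>q\<in>P. h q \<in> M0 \<and> h q \<preceq> snd q}"
    define Qh where "Qh h b \<longleftrightarrow>
      \<not> (\<exists>x. R x id \<and> teval M L x \<prec> b \<and> (\<forall>q\<in>P. teval M (fst q) x \<preceq> h q))" for h b
    define \<Q> where "\<Q> = insert (\<lambda>b. b \<preceq> t) ((\<lambda>m b. m \<prec> b) ` {m\<in>M0. m \<prec> t} \<union> Qh ` V)"
    obtain m0 where m0: "m0 \<in> M0" "m0 \<prec> t"
      using L(2) False ord.le_neq_trans by blast
    \<comment> \<open>Each condition holds at \<open>suc m\<close> for all sufficiently large
      \<open>m < t\<close> in \<open>M0\<close>, so any finitely many hold at a common one. The
      successor makes up for strictness: \<open>L x < suc m\<close> gives \<open>L x <= m\<close>,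
      and \<open>m\<close> is an allowed bound.\<close>
    have ev: "\<exists>m1\<in>M0. m1 \<prec> t \<and> (\<forall>m\<in>M0. m1 \<preceq> m \<and> m \<prec> t \<longrightarrow> Q (suc m))" if Q: "Q \<in> \<Q>" for Q
    proof -
      consider "Q = (\<lambda>b. b \<preceq> t)" | m where "m \<in> M0" "m \<prec> t" "Q = (\<lambda>b. m \<prec> b)"
        | h where "h \<in> V" "Q = Qh h"
        using Q unfolding \<Q>_def by auto
      then show ?thesis
      proof cases
        case 1
        then show ?thesis using m0 suc_le by (intro bexI[of _ m0]) simp_all
      next
        case (2 m1)
        have "m1 \<prec> suc m" if "m1 \<preceq> m" for m
          using that less_suc ord.le_less_trans by blast
        then show ?thesis using 2 by (intro bexI[of _ m1]) simp_all
      next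
        case (3 h)
        have "Qh h (suc m)" if "m \<in> M0" "m \<prec> t" for m
        proof -
          have "m \<preceq> t" using that(2) ord.less_imp_le by blast
          from empty[OF that(1) this, of h] 3(1) show ?thesis
            unfolding Qh_def V_def using less_suc_le by blast
        qed
        then show ?thesis using 3(2) m0 by (intro bexI[of _ m0]) simp_all
      qed
    qed
    have "\<exists>b. \<forall>Q\<in>\<Q>. Q b"
    proof (rule saturatedD[OF sat])
      show "small (B \<union> {t})" by (rule small_Un_finite[OF smallB]) simp
    next
      fix Q assume "Q \<in> \<Q>"
      then consider "Q = (\<lambda>b. b \<preceq> t)" | m where "m \<in> M0" "Q = (\<lambda>b. m \<prec> b)"
        | h where "h \<in> V" "Q = Qh h"
        unfolding \<Q>_def by auto
      then show "\<exists>R. dfn M (B \<union> {t}) R \<and> Q = (\<lambda>b. R (\<lambda>_. b) id)"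
      proof cases
        case 1
        have "dfn M (B \<union> {t}) (\<lambda>x f. teval M (PVar 0) x \<preceq> f t)"
          by (intro dfn_not dfn_param_less) simp
        then show ?thesis using 1 by (intro exI[of _ "\<lambda>x f. teval M (PVar 0) x \<preceq> f t"]) simp
      next
        case (2 m)
        have "dfn M (B \<union> {t}) (\<lambda>x f. f m \<prec> teval M (PVar 0) x)"
          using 2(1) MB by (intro dfn_param_less) blast
        then show ?thesis using 2 by (intro exI[of _ "\<lambda>x f. f m \<prec> teval M (PVar 0) x"]) simp
      next
        case (3 h)
        let ?S = "\<lambda>x f. R (x \<circ> Suc) f \<and> psat UNIV M (PLess (tren Suc L) (PVar 0)) x \<and>
          (\<forall>q\<in>P. teval M (fst q) (x \<circ> Suc) \<preceq> f (h q))"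
        have hB: "h q \<in> B" if "q \<in> P" for q using 3(1) that MB unfolding V_def by auto
        have "dfn M B ?S"
          by (intro dfn_conj dfn_ren[OF dR] dfn_psat[OF subsetD[OF MB zero_in_sub]]
              dfn_Ball[OF subsetD[OF MB zero_in_sub] insert.hyps(1)] dfn_not
              dfn_ren[OF dfn_param_less(2)] hB)
        from dfn_mono[OF dfn_not[OF dfn_ex_tail[OF this]] Un_upper1]
        have S: "dfn M (B \<union> {t}) (\<lambda>x f. \<not> (\<exists>y. ?S (case_nat (x 0) y) f))" .
        have "case_nat b y \<circ> Suc = y" for b :: 'm and y by auto
        then have "Qh h b \<longleftrightarrow> \<not> (\<exists>y. ?S (case_nat b y) id)" for b
          by (simp only: Qh_def psat.simps teval.simps teval_tren nat.case id_apply)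
        then have "Q = (\<lambda>b. \<not> (\<exists>y. ?S (case_nat b y) id))"
          unfolding 3(2) by (intro ext)
        with S show ?thesis by (intro exI[of _ "\<lambda>x f. \<not> (\<exists>y. ?S (case_nat (x 0) y) f)"] conjI)
      qed
    next
      fix F assume F: "finite F" "F \<subseteq> \<Q>"
      have "\<exists>m1\<in>M0. m1 \<prec> t \<and> (\<forall>Q\<in>F. \<forall>m\<in>M0. m1 \<preceq> m \<and> m \<prec> t \<longrightarrow> Q (suc m))"
        using F
      proof (induction F)
        case empty
        then show ?case using m0 by auto
      next
        case (insert Q F)
        from insert.prems have "Q \<in> \<Q>" "F \<subseteq> \<Q>" by simp_all
        from insert.IH[OF this(2)] obtain m1 where
          m1: "m1 \<in> M0" "m1 \<prec> t" "\<forall>Q\<in>F. \<forall>m\<in>M0. m1 \<preceq> m \<and> m \<prec> t \<longrightarrow> Q (suc m)"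
          by (elim bexE conjE)
        from ev[OF \<open>Q \<in> \<Q>\<close>] obtain m2 where
          m2: "m2 \<in> M0" "m2 \<prec> t" "\<forall>m\<in>M0. m2 \<preceq> m \<and> m \<prec> t \<longrightarrow> Q (suc m)"
          by (elim bexE conjE)
        define m3 where "m3 = (if m1 \<prec> m2 then m2 else m1)"
        have m3: "m3 \<in> M0" "m3 \<prec> t" "m1 \<preceq> m3" "m2 \<preceq> m3"
          using m1(1,2) m2(1,2) less_irrefl ord.less_imp_le by (auto simp: m3_def)
        have le: "m1 \<preceq> m" "m2 \<preceq> m" if "m3 \<preceq> m" for m
          using ord.order_trans[OF m3(3) that] ord.order_trans[OF m3(4) that] .
        show ?case
        proof (intro bexI[OF _ m3(1)] conjI m3(2) ballI impI)
          fix Q' m assume Q': "Q' \<in> insert Q F" and m: "m \<in> M0" "m3 \<preceq> m \<and> m \<prec> t"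
          show "Q' (suc m)"
          proof (cases "Q' = Q")
            case True
            then show ?thesis using bspec[OF m2(3) m(1)] le m(2) by simp
          next
            case False
            then have "Q' \<in> F" using Q' by simp
            from bspec[OF bspec[OF m1(3) this] m(1)] show ?thesis using le m(2) by simp
          qed
        qed
      qed
      then obtain m1 where
        m1: "m1 \<in> M0" "m1 \<prec> t" "\<forall>Q\<in>F. \<forall>m\<in>M0. m1 \<preceq> m \<and> m \<prec> t \<longrightarrow> Q (suc m)"
        by (elim bexE conjE)
      have "\<forall>Q\<in>F. Q (suc m1)"
      proof
        fix Q assume "Q \<in> F"
        from bspec[OF bspec[OF m1(3) this] m1(1)] show "Q (suc m1)"
          using m1(2) less_irrefl[of m1] by simp
      qed
      then show "\<exists>b. \<forall>Q\<in>F. Q b" by (rule exI)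
    qed
    then obtain t' where t': "\<forall>Q\<in>\<Q>. Q t'" ..
    have le: "t' \<preceq> t" using t' by (simp add: \<Q>_def)
    have gt: "m \<prec> t'" if "m \<in> M0" "m \<prec> t" for m
      using t' that by (simp add: \<Q>_def ball_Un)
    have Qh: "Qh h t'" if "h \<in> V" for h
      using t' that by (simp add: \<Q>_def ball_Un)
    have miss: "missing t' t"
      unfolding missing_def
    proof (intro conjI le ballI)
      fix m assume "m \<in> M0"
      then show "m \<prec> t' \<or> t \<prec> m" using gt False less_linear by blast
    qed
    \<comment> \<open>\<open>t'\<close> becomes a new parameter, which is why the induction runs
      over all small \<open>B\<close> above \<open>M0\<close>; the bounds \<open>h\<close> still
      come from \<open>M0\<close>.\<close>
    define R' where "R' = (\<lambda>x f. R x f \<and> teval M L x \<prec> f t')"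
    have small': "small (insert t' B)" using small_Un_finite[OF smallB, of "{t'}"] by simp
    have "dfn M (insert t' B) R'"
      unfolding R'_def by (intro dfn_conj dfn_mono[OF dR] dfn_param_less) auto
    moreover have "\<forall>h. (\<forall>p\<in>P. h p \<in> M0 \<and> h p \<preceq> snd p) \<longrightarrow>
      \<not> (\<exists>x. R' x id \<and> (\<forall>p\<in>P. teval M (fst p) x \<preceq> h p))"
      using Qh by (simp add: R'_def Qh_def V_def)
    ultimately have "\<exists>st. (\<forall>s\<in>set st. good_strip n s) \<and>
      (\<forall>x. R' x id \<and> (\<forall>p\<in>P. teval M (fst p) x \<preceq> snd p) \<longrightarrow> (\<exists>s\<in>set st. in_strip x s))"
      by (intro insert.IH[OF subset_insertI2[OF MB] small' _ P])
    then obtain st where st: "\<forall>s\<in>set st. good_strip n s"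
      "\<forall>x. R' x id \<and> (\<forall>p\<in>P. teval M (fst p) x \<preceq> snd p) \<longrightarrow> (\<exists>s\<in>set st. in_strip x s)"
      by (elim exE conjE)
    show ?thesis
    proof (intro exI[of _ "(L, t', t) # st"] conjI allI impI)
      show "\<forall>s\<in>set ((L, t', t) # st). good_strip n s" using st(1) L(1) miss by simp
      fix x assume x: "R x id \<and> (\<forall>p\<in>insert p P. teval M (fst p) x \<preceq> snd p)"
      show "\<exists>s\<in>set ((L, t', t) # st). in_strip x s"
      proof (cases "teval M L x \<prec> t'")
        case True
        then show ?thesis using st(2)[rule_format, of x] x by (simp add: R'_def)
      next
        case False
        then show ?thesis using x by (simp add: p)
      qed
    qed
  qed
qed

text \<open>The parameters fix the truth of \<open>E\<close> and the value of each bound. If some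
  bound lies below all of \<open>M0\<close>, boundedness makes the cell empty or part of a single
  strip; otherwise each bound has an element of \<open>M0\<close> at or below it, as
  \<open>cover\<close> requires.\<close>

lemma bounded_cell_cover:
  assumes c: "wf_cell n c"
    and bdd: "\<forall>x. length x = n \<and> in_cell M (asg n x a) c \<longrightarrow>
      (\<forall>i<n. neg \<alpha> \<prec> x ! i \<and> x ! i \<prec> \<alpha>)"
    and no_points: "\<forall>x. length x = n \<and> in_cell M (asg n x a) c \<longrightarrow> \<not> set x \<subseteq> M0"
  shows "\<exists>st. (\<forall>s\<in>set st. good_strip n s) \<and>
    (\<forall>x. length x = n \<and> in_cell M (asg n x a) c \<longrightarrow> (\<exists>s\<in>set st. in_strip (nth x) s))"
proof -
  obtain P C E where PCE: "c = (P, C, E)" by (cases c)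
  define va where "va = (\<lambda>i. a ! (i - n))"
  have wf: "tvars L \<subseteq> {..<n}" "tvars T \<inter> {..<n} = {}" if "(L, T) \<in> set P" for L T
    using c that by (auto simp: wf_cell_def PCE)
  have wfC: "fv C \<subseteq> {..<n}" "fv E \<inter> {..<n} = {}" using c by (auto simp: wf_cell_def PCE)
  have L: "teval M L (asg n x a) = teval M L (nth x)" if "tvars L \<subseteq> {..<n}" for L x
    by (rule teval_cong) (use that in \<open>auto simp: asg_def\<close>)
  have T: "teval M T (asg n x a) = teval M T va" if "tvars T \<inter> {..<n} = {}" for T x
    by (rule teval_cong) (use that in \<open>auto simp: asg_def va_def\<close>)
  have CC: "psat UNIV M C (asg n x a) = psat UNIV M C (nth x)" for x
    by (rule psat_cong) (use wfC in \<open>auto simp: asg_def\<close>)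
  have EE: "psat UNIV M E (asg n x a) = psat UNIV M E va" for x
    by (rule psat_cong) (use wfC in \<open>auto simp: asg_def va_def\<close>)
  define P' where "P' = (\<lambda>(L, T). (L, teval M T va)) ` set P"
  have P': "tvars (fst p) \<subseteq> {..<n}" if p: "p \<in> P'" for p
  proof -
    obtain L T where "(L, T) \<in> set P" "p = (L, teval M T va)"
      using p by (auto simp: P'_def)
    then show ?thesis using wf(1) by simp
  qed
  have finP: "finite P'" by (simp add: P'_def)
  have "(\<forall>(L, T)\<in>set P. teval M L (asg n x a) \<preceq> teval M T (asg n x a)) \<longleftrightarrow>
      (\<forall>p\<in>P'. teval M (fst p) (nth x) \<preceq> snd p)" for x
  proof -
    have "(\<forall>(L, T)\<in>set P. teval M L (asg n x a) \<preceq> teval M T (asg n x a)) \<longleftrightarrow>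
      (\<forall>(L, T)\<in>set P. teval M L (nth x) \<preceq> teval M T va)"
      by (rule ball_cong) (auto simp: L[OF wf(1)] T[OF wf(2)])
    then show ?thesis by (simp add: P'_def case_prod_beta)
  qed
  then have cell: "in_cell M (asg n x a) c \<longleftrightarrow> (\<forall>p\<in>P'. teval M (fst p) (nth x) \<preceq> snd p) \<and>
      psat UNIV M C (nth x) \<and> psat UNIV M E va" for x
    by (simp add: in_cell_def PCE CC EE)
  consider "\<not> psat UNIV M E va" | p where "p \<in> P'" "\<forall>m\<in>M0. snd p \<prec> m"
    | "psat UNIV M E va" "\<forall>p\<in>P'. \<exists>m\<in>M0. m \<preceq> snd p"
    by blast
  then show ?thesis
  proof cases
    case 1
    then show ?thesis using cell by (intro exI[of _ "[]"]) simp
  next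
    case (2 p)
    obtain L t where p: "p = (L, t)" by (cases p)
    have tL: "tvars L \<subseteq> {..<n}" using P'[OF 2(1)] by (simp add: p)
    from term_bounded[OF this, of \<alpha>] obtain \<beta> where
      \<beta>: "\<forall>x. (\<forall>i\<in>{..<n}. neg \<alpha> \<prec> x i \<and> x i \<prec> \<alpha>) \<longrightarrow> neg \<beta> \<prec> teval M L x \<and> teval M L x \<prec> \<beta>" ..
    have st: "neg \<beta> \<preceq> teval M L (nth x)" "teval M L (nth x) \<preceq> t"
      if "length x = n" "in_cell M (asg n x a) c" for x
    proof -
      have "\<forall>i\<in>{..<n}. neg \<alpha> \<prec> nth x i \<and> nth x i \<prec> \<alpha>"
        using bdd[THEN spec, THEN mp, OF conjI, OF that] by simp
      from \<beta>[THEN spec, THEN mp, OF this] have "neg \<beta> \<prec> teval M L (nth x)" ..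
      then show "neg \<beta> \<preceq> teval M L (nth x)" using ord.less_imp_le by blast
      show "teval M L (nth x) \<preceq> t"
        using that(2)[unfolded cell, THEN conjunct1, THEN bspec, OF 2(1)] by (simp add: p)
    qed
    show ?thesis
    proof (cases "t \<prec> neg \<beta>")
      case True
      have "\<not> (length x = n \<and> in_cell M (asg n x a) c)" for x
        using st[of x] ord.order_trans True by blast
      then show ?thesis by (intro exI[of _ "[]"]) simp
    next
      case False
      then have "missing (neg \<beta>) t" using 2(2) by (simp add: missing_def p)
      then show ?thesis using st tL by (intro exI[of _ "[(L, neg \<beta>, t)]"]) simp
    qed
  next
    case 3
    have "\<exists>st. (\<forall>s\<in>set st. good_strip n s) \<and>
      (\<forall>x. psat UNIV M C x \<and> (\<forall>p\<in>P'. teval M (fst p) x \<preceq> snd p) \<longrightarrow> (\<exists>s\<in>set st. in_strip x s))"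
    proof (rule cover[of P' M0 "\<lambda>x f. psat UNIV M C x"])
      show "finite P'" by (rule finP)
      show "dfn M M0 (\<lambda>x f. psat UNIV M C x)" by (rule dfn_psat[OF zero_in_sub])
      show "\<forall>p\<in>P'. tvars (fst p) \<subseteq> {..<n} \<and> (\<exists>m\<in>M0. m \<preceq> snd p)" using P' 3(2) by blast
      show "\<forall>h. (\<forall>p\<in>P'. h p \<in> M0 \<and> h p \<preceq> snd p) \<longrightarrow>
        \<not> (\<exists>x. psat UNIV M C x \<and> (\<forall>p\<in>P'. teval M (fst p) x \<preceq> h p))"
      \<comment> \<open>With bounds \<open>h p\<close> from \<open>M0\<close> the system is
        definable over \<open>M0\<close>, so a solution could be chosen with all coordinates in
        \<open>M0\<close>; as \<open>h p <= snd p\<close>, it would be a point of the cell.\<close>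
      proof (intro allI impI notI)
        fix h assume h: "\<forall>p\<in>P'. h p \<in> M0 \<and> h p \<preceq> snd p"
          and "\<exists>x. psat UNIV M C x \<and> (\<forall>p\<in>P'. teval M (fst p) x \<preceq> h p)"
        then obtain x where x: "psat UNIV M C x" "\<forall>p\<in>P'. teval M (fst p) x \<preceq> h p"
          by (elim exE conjE)
        have "dfn M M0 (\<lambda>x f. psat UNIV M C x \<and> (\<forall>p\<in>P'. teval M (fst p) x \<preceq> f (h p)))"
          using h finP by (intro dfn_conj dfn_psat[OF zero_in_sub] dfn_Ball[OF zero_in_sub] dfn_not
              dfn_param_less) simp_all
        from sub_exists[OF this, of x] x have "\<exists>y. range y \<subseteq> M0 \<and> psat UNIV M C y \<and>
          (\<forall>p\<in>P'. teval M (fst p) y \<preceq> h p)" by simp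
        then obtain y where
          y: "range y \<subseteq> M0" "psat UNIV M C y" "\<forall>p\<in>P'. teval M (fst p) y \<preceq> h p"
          by (elim exE conjE)
        define z where "z = map y [0..<n]"
        have "psat UNIV M C (nth z) = psat UNIV M C y"
          by (rule psat_cong) (use wfC in \<open>auto simp: z_def\<close>)
        moreover have "teval M (fst p) (nth z) = teval M (fst p) y" if "p \<in> P'" for p
          by (rule teval_cong) (use P'[OF that] in \<open>auto simp: z_def\<close>)
        moreover have "teval M (fst p) y \<preceq> snd p" if "p \<in> P'" for p
          using ord.order_trans[OF bspec[OF y(3) that]] bspec[OF h that] by blast
        ultimately have "in_cell M (asg n z a) c"
          using y(2) 3(1) by (simp add: cell)
        moreover have "length z = n" "set z \<subseteq> M0" using y(1) by (auto simp: z_def)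
        ultimately show False using no_points[THEN spec, of z] by simp
      qed
    qed (simp_all add: small_sub)
    then obtain st where "\<forall>s\<in>set st. good_strip n s"
      "\<forall>x. psat UNIV M C x \<and> (\<forall>p\<in>P'. teval M (fst p) x \<preceq> snd p) \<longrightarrow> (\<exists>s\<in>set st. in_strip x s)"
      by (elim exE conjE)
    then show ?thesis by (intro exI[of _ st]) (simp add: cell)
  qed
qed

lemma bounded_cover:
  assumes bdd: "bounded_pres M n (defset M \<phi> n a)"
    and no_points: "defset M \<phi> n a \<inter> {x. set x \<subseteq> M0} = {}"
  shows "\<exists>st. (\<forall>s\<in>set st. good_strip n s) \<and>
    (\<forall>x\<in>defset M \<phi> n a. \<exists>s\<in>set st. in_strip (nth x) s)"
proof -
  from cell_decomposition[OF models, of n \<phi>] obtain cs where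
    wf: "\<forall>c\<in>set cs. wf_cell n c"
    and cs: "\<forall>v. psat UNIV M \<phi> v \<longleftrightarrow> (\<exists>c\<in>set cs. in_cell M v c)"
    by (elim exE conjE)
  have X: "x \<in> defset M \<phi> n a \<longleftrightarrow> length x = n \<and> (\<exists>c\<in>set cs. in_cell M (asg n x a) c)" for x
    unfolding defset_def by (simp add: cs)
  obtain \<alpha> where \<alpha>: "\<forall>x\<in>defset M \<phi> n a. \<forall>i<n. neg \<alpha> \<prec> x ! i \<and> x ! i \<prec> \<alpha>"
    using bdd unfolding bounded_pres_def by (elim exE conjE)
  have "\<exists>st. (\<forall>s\<in>set st. good_strip n s) \<and>
    (\<forall>x. length x = n \<and> in_cell M (asg n x a) c \<longrightarrow> (\<exists>s\<in>set st. in_strip (nth x) s))"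
    if c: "c \<in> set cs" for c
  proof (rule bounded_cell_cover[OF bspec[OF wf c]])
    show "\<forall>x. length x = n \<and> in_cell M (asg n x a) c \<longrightarrow> (\<forall>i<n. neg \<alpha> \<prec> x ! i \<and> x ! i \<prec> \<alpha>)"
      using \<alpha> c X by blast
    show "\<forall>x. length x = n \<and> in_cell M (asg n x a) c \<longrightarrow> \<not> set x \<subseteq> M0"
      using no_points c X by blast
  qed
  then obtain g where g: "\<forall>c\<in>set cs. (\<forall>s\<in>set (g c). good_strip n s) \<and>
    (\<forall>x. length x = n \<and> in_cell M (asg n x a) c \<longrightarrow> (\<exists>s\<in>set (g c). in_strip (nth x) s))"
    by metis
  show ?thesis
  proof (intro exI[of _ "concat (map g cs)"] conjI ballI)
    show "good_strip n s" if "s \<in> set (concat (map g cs))" for s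
      using that g by auto
    fix x assume "x \<in> defset M \<phi> n a"
    then obtain c where c: "length x = n" "c \<in> set cs" "in_cell M (asg n x a) c" using X by blast
    with g have "\<exists>s\<in>set (g c). in_strip (nth x) s" by blast
    then show "\<exists>s\<in>set (concat (map g cs)). in_strip (nth x) s"
      using c(2) by auto
  qed
qed

section \<open>Forking and the finite intersection property\<close>

lemma forks_of_cover:
  assumes st: "\<forall>s\<in>set st. good_strip n s"
    and cov: "\<forall>x\<in>defset M \<phi> n a. \<exists>s\<in>set st. in_strip (nth x) s"
  shows "forks M M0 n \<phi> a"
  unfolding forks_def
proof (intro exI[of _ "map (\<lambda>(L, l, u). (strip_fm L n, [l, u])) st"] conjI)
  show "\<forall>(\<psi>, b)\<in>set (map (\<lambda>(L, l, u). (strip_fm L n, [l, u])) st).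
      fv \<psi> \<subseteq> {..<n + length b} \<and> divides M M0 n \<psi> b"
  proof clarsimp
    fix L l u assume "(L, l, u) \<in> set st"
    then have "tvars L \<subseteq> {..<n}" "missing l u" using bspec[OF st] by force+
    then show "fv (strip_fm L n) \<subseteq> {..<Suc (Suc n)} \<and> divides M M0 n (strip_fm L n) [l, u]"
      using strip_divides by (auto simp: strip_fm_def)
  qed
  show "defset M \<phi> n a \<subseteq>
      (\<Union>(\<psi>, b)\<in>set (map (\<lambda>(L, l, u). (strip_fm L n, [l, u])) st). defset M \<psi> n b)"
  proof
    fix x assume x: "x \<in> defset M \<phi> n a"
    then obtain L l u where s: "(L, l, u) \<in> set st" "in_strip (nth x) (L, l, u)"
      using cov by (metis prod_cases3)
    then have "tvars L \<subseteq> {..<n}" using bspec[OF st] by force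
    then have "x \<in> defset M (strip_fm L n) n [l, u]"
      using x s(2) psat_strip_fm by (simp add: defset_def)
    then show "x \<in> (\<Union>(\<psi>, b)\<in>set (map (\<lambda>(L, l, u). (strip_fm L n, [l, u])) st). defset M \<psi> n b)"
      using s(1) by force
  qed
qed

text \<open>As \<open>f\<close> fixes \<open>M0\<close> pointwise, an end and its image determine
  the same cut, so the interval spanned by a strip and its image still contains no point of
  \<open>M0\<close>.\<close>

lemma missing_hull:
  assumes f: "elem_map M f B" and B: "M0 \<subseteq> B" "l \<in> B" "u \<in> B" and fix': "\<forall>m\<in>M0. f m = m"
    and miss: "missing l u"
  shows "missing (if l \<prec> f l then l else f l) (if u \<prec> f u then f u else u)"
  unfolding missing_def
proof (intro conjI ballI)
  have "l \<preceq> u" using miss by (simp add: missing_def)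
  then show "(if l \<prec> f l then l else f l) \<preceq> (if u \<prec> f u then f u else u)"
    using less_trans less_linear by (metis (full_types))
  fix m assume m: "m \<in> M0"
  have l: "m \<prec> l \<longleftrightarrow> m \<prec> f l" using elem_map_less[OF f, of m l] m B fix' by auto
  have u: "u \<prec> m \<longleftrightarrow> f u \<prec> m" using elem_map_less[OF f, of u m] m B fix' by auto
  have "m \<prec> l \<or> u \<prec> m" using miss m by (simp add: missing_def)
  then show "m \<prec> (if l \<prec> f l then l else f l) \<or> (if u \<prec> f u then f u else u) \<prec> m"
    using l u by auto
qed

text \<open>By induction on the number of strips: apply to everything an elementary map moving the first
  strip off itself. The intersection with the image no longer needs the first strip, and each
  other strip is merged with its image.\<close>
lemma no_fip_of_cover:
  assumes fv: "fv \<phi> \<subseteq> {..<n + length a}"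
    and "finite Y" "\<forall>y\<in>Y. same_type M M0 a y" "\<forall>s\<in>set st. good_strip n s"
    and "\<forall>x. (\<forall>y\<in>Y. psat UNIV M \<phi> (asg n (map x [0..<n]) y)) \<longrightarrow> (\<exists>s\<in>set st. in_strip x s)"
  shows "\<exists>F. finite F \<and> (\<forall>y\<in>F. same_type M M0 a y) \<and>
    \<not> (\<exists>x. \<forall>y\<in>F. psat UNIV M \<phi> (asg n (map x [0..<n]) y))"
  using assms(2-)
proof (induction "length st" arbitrary: Y st)
  case 0
  then show ?case by (intro exI[of _ Y]) simp
next
  case (Suc k)
  note Y = Suc.prems(1,2) and good = Suc.prems(3) and cov = Suc.prems(4)
  obtain L l u st1 where st: "st = (L, l, u) # st1"
    using Suc.hyps(2) by (cases st) auto
  have miss: "missing l u" using good by (simp add: st)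
  \<comment> \<open>All entries of the tuples in \<open>Y\<close> and all strip ends, so that one
    map \<open>f\<close> moves the whole configuration.\<close>
  define D where "D = \<Union> (set ` Y) \<union> (\<Union>(L, l, u)\<in>set st. {l, u})"
  have D: "finite D" using Y(1) by (auto simp: D_def)
  from conjugate_above[OF miss D] obtain f where
    f: "elem_map M f (insert l M0 \<union> D)" "\<forall>m\<in>M0. f m = m" "u \<prec> f l"
    by (elim exE conjE)
  let ?B = "insert l M0 \<union> D"
  have MB: "M0 \<subseteq> ?B" by blast
  have len: "length y = length a" if "y \<in> Y" for y
    using Y(2) that by (auto simp: same_type_def)
  have set: "set y \<subseteq> ?B" if "y \<in> Y" for y using that by (auto simp: D_def)
  have ends: "l' \<in> ?B" "u' \<in> ?B" if "(L', l', u') \<in> set st" for L' l' u'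
    using that by (force simp: D_def)+
  have type: "same_type M M0 a (map f y)" if "y \<in> Y" for y
  proof (rule same_type_trans)
    show "same_type M M0 a y" using Y(2) that by simp
    show "same_type M M0 y (map f y)"
      by (rule elem_map_same_type[OF f(1) _ _ set[OF that]]) (use f(2) in auto)
  qed
  let ?\<Phi> = "\<lambda>y x f. psat UNIV M \<phi> (\<lambda>i. case if i < n then Inl i else Inr (y ! (i - n)) of
      Inl j \<Rightarrow> x j | Inr m \<Rightarrow> f m)"
  let ?S = "\<lambda>s x f. f (fst (snd s)) \<preceq> teval M (fst s) x \<and> teval M (fst s) x \<preceq> f (snd (snd s))"
  have \<Phi>: "?\<Phi> y x g = psat UNIV M \<phi> (asg n (map x [0..<n]) (map g y))" if "y \<in> Y" for y x g
    by (rule psat_cong) (use fv len[OF that] in \<open>auto simp: asg_def\<close>)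
  have d\<Phi>: "dfn M ?B (?\<Phi> y)" if y: "y \<in> Y" for y
  proof (rule dfn_fm[where b = l])
    fix i m assume i: "i \<in> fv \<phi>" "(if i < n then Inl i else Inr (y ! (i - n))) = Inr m"
    then have "m = y ! (i - n)" "\<not> i < n" by (auto split: if_splits)
    moreover have "i < n + length a" using fv i(1) by auto
    ultimately have "m \<in> set y" using len[OF y] by simp
    then show "m \<in> ?B" using set[OF y] by blast
  qed simp
  have dS: "dfn M ?B (?S s)" if s: "s \<in> set st" for s
  proof -
    obtain L' l' u' where "s = (L', l', u')" by (cases s)
    then have "fst (snd s) \<in> ?B" "snd (snd s) \<in> ?B" using s ends by simp_all
    then show ?thesis by (intro dfn_conj dfn_not dfn_param_less)
  qed
  \<comment> \<open>That the strips cover the intersection of the conjugates in \<open>Y\<close> is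
    a closed statement over \<open>?B\<close>; applying \<open>f\<close> shows that the image strips
    cover the intersection of the image conjugates.\<close>
  have "dfn M ?B (\<lambda>x f. (\<forall>y\<in>Y. ?\<Phi> y x f) \<and> (\<forall>s\<in>set st. \<not> ?S s x f))"
    by (intro dfn_conj[OF dfn_Ball[of l, OF _ Y(1) d\<Phi>] dfn_Ball[of l, OF _ finite_set dfn_not[OF dS]]])
      simp_all
  note closed = elem_map_closed_dfn[OF f(1) dfn_not[OF dfn_ex_all[OF this]]]
  have transfer: "(\<not> (\<exists>x. (\<forall>y\<in>Y. ?\<Phi> y x id) \<and> (\<forall>s\<in>set st. \<not> ?S s x id))) =
    (\<not> (\<exists>x. (\<forall>y\<in>Y. ?\<Phi> y x f) \<and> (\<forall>s\<in>set st. \<not> ?S s x f)))"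
    by (rule closed[of l]) simp
  have cov1: "\<exists>s\<in>set st. ?S s x id" if x: "\<forall>y\<in>Y. ?\<Phi> y x id" for x
  proof -
    have "psat UNIV M \<phi> (asg n (map x [0..<n]) y)" if y: "y \<in> Y" for y
      using bspec[OF x y] unfolding \<Phi>[OF y] by simp
    with cov have "\<exists>s\<in>set st. in_strip x s" by simp
    then obtain s where s: "s \<in> set st" "in_strip x s" ..
    have "?S s x id" using s(2) by (cases s) simp
    then show ?thesis using s(1) by (rule bexI)
  qed
  have "\<not> (\<exists>x. (\<forall>y\<in>Y. ?\<Phi> y x id) \<and> (\<forall>s\<in>set st. \<not> ?S s x id))"
  proof (rule notI, elim exE conjE)
    fix x assume x: "\<forall>y\<in>Y. ?\<Phi> y x id" and no: "\<forall>s\<in>set st. \<not> ?S s x id"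
    from cov1[OF x] obtain s where s: "s \<in> set st" "?S s x id" ..
    from bspec[OF no s(1)] s(2) show False by (rule notE)
  qed
  then have none: "\<not> (\<exists>x. (\<forall>y\<in>Y. ?\<Phi> y x f) \<and> (\<forall>s\<in>set st. \<not> ?S s x f))"
    by (rule iffD1[OF transfer])
  have cov': "\<exists>s\<in>set st. ?S s x f"
    if x: "\<forall>y\<in>Y. psat UNIV M \<phi> (asg n (map x [0..<n]) (map f y))" for x
  proof (rule ccontr)
    assume "\<not> (\<exists>s\<in>set st. ?S s x f)"
    then have "\<forall>s\<in>set st. \<not> ?S s x f" by (simp only: bex_simps simp_thms)
    moreover have "\<forall>y\<in>Y. ?\<Phi> y x f"
    proof
      fix y assume y: "y \<in> Y"
      show "?\<Phi> y x f" unfolding \<Phi>[OF y] by (rule bspec[OF x y])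
    qed
    ultimately show False using none by (elim notE) (intro exI conjI)
  qed
  define hull where "hull = (\<lambda>(L, l, u).
    (L :: ptm, if l \<prec> f l then l else f l, if u \<prec> f u then f u else u))"
  have mn: "(if b \<prec> c then b else c) \<preceq> b" "(if b \<prec> c then b else c) \<preceq> c" for b c
    by (split if_split; use less_irrefl less_trans in blast)+
  have mx: "b \<preceq> (if b \<prec> c then c else b)" "c \<preceq> (if b \<prec> c then c else b)" for b c
    by (split if_split; use less_irrefl less_trans in blast)+
  have hull1: "in_strip x (hull s)" if xs: "in_strip x s" for x s
  proof -
    obtain L' l' u' where s: "s = (L', l', u')" by (cases s)
    show ?thesis
      unfolding s hull_def prod.case in_strip.simps
    proof
      show "(if l' \<prec> f l' then l' else f l') \<preceq> teval M L' x"
        by (rule ord.order_trans[OF mn(1)]) (use xs s in simp)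
      show "teval M L' x \<preceq> (if u' \<prec> f u' then f u' else u')"
        by (rule ord.order_trans[OF _ mx(1)]) (use xs s in simp)
    qed
  qed
  have hull2: "in_strip x (hull s)" if xs: "?S s x f" for x s
  proof -
    obtain L' l' u' where s: "s = (L', l', u')" by (cases s)
    show ?thesis
      unfolding s hull_def prod.case in_strip.simps
    proof
      show "(if l' \<prec> f l' then l' else f l') \<preceq> teval M L' x"
        by (rule ord.order_trans[OF mn(2)]) (use xs s in simp)
      show "teval M L' x \<preceq> (if u' \<prec> f u' then f u' else u')"
        by (rule ord.order_trans[OF _ mx(2)]) (use xs s in simp)
    qed
  qed
  show ?case
  proof (rule Suc.hyps(1)[of "map hull st1" "Y \<union> map f ` Y"])
    show "k = length (map hull st1)" using Suc.hyps(2) by (simp add: st)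
    show "finite (Y \<union> map f ` Y)" using Y(1) by simp
    show "\<forall>y\<in>Y \<union> map f ` Y. same_type M M0 a y" using Y(2) type by blast
    show "\<forall>s\<in>set (map hull st1). good_strip n s"
    proof
      fix s assume "s \<in> set (map hull st1)"
      then obtain L' l' u' where s: "s = hull (L', l', u')" "(L', l', u') \<in> set st" by (auto simp: st)
      have "good_strip n (L', l', u')" using good s(2) by blast
      then show "good_strip n s"
        using missing_hull[OF f(1) MB ends[OF s(2)] f(2)] by (auto simp: hull_def s(1))
    qed
    show "\<forall>x. (\<forall>y\<in>Y \<union> map f ` Y. psat UNIV M \<phi> (asg n (map x [0..<n]) y)) \<longrightarrow>
        (\<exists>s\<in>set (map hull st1). in_strip x s)"
    proof (intro allI impI)
      fix x assume x: "\<forall>y\<in>Y \<union> map f ` Y. psat UNIV M \<phi> (asg n (map x [0..<n]) y)"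
      have "\<exists>s\<in>set st. in_strip x s" by (rule cov[THEN spec, THEN mp]) (use x in simp)
      then obtain s where s: "s \<in> set st" "in_strip x s" ..
      have "\<exists>s\<in>set st. ?S s x f" by (rule cov') (use x in simp)
      then obtain s' where s': "s' \<in> set st" "?S s' x f" ..
      \<comment> \<open>\<open>u < f l\<close> separates the first strip from its image, so
        \<open>s\<close> or \<open>s'\<close> comes from \<open>st1\<close>, and its hull contains
        \<open>x\<close>.\<close>
      have "\<not> (s = (L, l, u) \<and> s' = (L, l, u))"
      proof
        assume "s = (L, l, u) \<and> s' = (L, l, u)"
        then have "teval M L x \<preceq> u" "f l \<preceq> teval M L x" using s(2) s'(2) by simp_all
        then show False using ord.le_less_trans[OF _ f(3)] by blast
      qed
      then consider "s \<in> set st1" | "s' \<in> set st1" using s(1) s'(1) by (auto simp: st)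
      then show "\<exists>s\<in>set (map hull st1). in_strip x s"
      proof cases
        case 1
        then show ?thesis using hull1[OF s(2)] by (intro bexI[of _ "hull s"]) simp_all
      next
        case 2
        then show ?thesis using hull2[OF s'(2)] by (intro bexI[of _ "hull s'"]) simp_all
      qed
    qed
  qed
qed

lemma in_strip_map: "good_strip n s \<Longrightarrow> in_strip (nth (map x [0..<n])) s = in_strip x s"
proof (cases s)
  case (fields L l u)
  assume "good_strip n s"
  then have "teval M L (nth (map x [0..<n])) = teval M L x"
    by (intro teval_cong) (auto simp: fields)
  then show ?thesis by (simp only: fields in_strip.simps)
qed

text \<open>The point lies in some dividing set of the cover. Having coordinates in
  \<open>M0\<close>, it satisfies every conjugate of that formula, so no \<open>k\<close> conjugates
  are inconsistent.\<close>

lemma points_imp_not_forks: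
  assumes fv: "fv \<phi> \<subseteq> {..<n + length a}" and x: "x \<in> defset M \<phi> n a" "set x \<subseteq> M0"
  shows "\<not> forks M M0 n \<phi> a"
proof
  assume "forks M M0 n \<phi> a"
  then obtain \<Psi> where \<Psi>: "\<forall>(\<psi>, b)\<in>set \<Psi>. fv \<psi> \<subseteq> {..<n + length b} \<and> divides M M0 n \<psi> b"
    "defset M \<phi> n a \<subseteq> (\<Union>(\<psi>, b)\<in>set \<Psi>. defset M \<psi> n b)"
    unfolding forks_def by (elim exE conjE)
  from subsetD[OF \<Psi>(2) x(1)] obtain \<psi> b where "(\<psi>, b) \<in> set \<Psi>" "x \<in> defset M \<psi> n b" by auto
  then have b: "fv \<psi> \<subseteq> {..<n + length b}" "divides M M0 n \<psi> b"
    and xb: "length x = n" "psat UNIV M \<psi> (asg n x b)"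
    using \<Psi>(1) by (auto simp: defset_def)
  from b(2) show False
    unfolding divides_def
  proof (elim exE conjE)
    fix c :: "nat \<Rightarrow> 'm list" and k
    assume c: "\<forall>i. same_type M M0 b (c i)"
      "\<forall>I. finite I \<longrightarrow> card I = k \<longrightarrow> \<not> (\<exists>x. length x = n \<and> (\<forall>i\<in>I. psat UNIV M \<psi> (asg n x (c i))))"
    have "psat UNIV M \<psi> (asg n x (c i))" for i
      using same_type_psat_asg[OF spec[OF c(1)] b(1) xb(1) x(2) zero_in_sub] xb(2) by simp
    then have "\<exists>x. length x = n \<and> (\<forall>i\<in>{..<k}. psat UNIV M \<psi> (asg n x (c i)))"
      using xb(1) by (intro exI[of _ x]) simp
    moreover have "\<not> (\<exists>x. length x = n \<and> (\<forall>i\<in>{..<k}. psat UNIV M \<psi> (asg n x (c i))))"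
      by (rule c(2)[THEN spec, THEN mp, THEN mp]) simp_all
    ultimately show False by simp
  qed
qed

text \<open>One point of \<open>M0\<close> serves for all finite families, since membership is
  decided by the type over \<open>M0\<close>.\<close>

lemma points_imp_fip:
  assumes fv: "fv \<phi> \<subseteq> {..<n + length a}" and x: "x \<in> defset M \<phi> n a" "set x \<subseteq> M0"
  shows "fip_type M M0 n \<phi> a"
  unfolding fip_type_def
proof (intro allI impI exI[of _ x] conjI ballI)
  show len: "length x = n" using x(1) by (simp add: defset_def)
  fix F y assume "F \<subseteq> {y. same_type M M0 a y}" "y \<in> F"
  then have "same_type M M0 a y" by blast
  from same_type_psat_asg[OF this fv len x(2) zero_in_sub]
  show "psat UNIV M \<phi> (asg n x y)" using x(1) by (simp add: defset_def)
qed

lemma cover_imp_not_fip: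
  assumes fv: "fv \<phi> \<subseteq> {..<n + length a}" and st: "\<forall>s\<in>set st. good_strip n s"
    and cov: "\<forall>x\<in>defset M \<phi> n a. \<exists>s\<in>set st. in_strip (nth x) s"
  shows "\<not> fip_type M M0 n \<phi> a"
proof -
  have cov1: "\<forall>x. (\<forall>y\<in>{a}. psat UNIV M \<phi> (asg n (map x [0..<n]) y)) \<longrightarrow> (\<exists>s\<in>set st. in_strip x s)"
  proof (intro allI impI)
    fix x assume "\<forall>y\<in>{a}. psat UNIV M \<phi> (asg n (map x [0..<n]) y)"
    then have "map x [0..<n] \<in> defset M \<phi> n a" by (simp add: defset_def)
    from bspec[OF cov this] obtain s where "s \<in> set st" "in_strip (nth (map x [0..<n])) s" ..
    then show "\<exists>s\<in>set st. in_strip x s"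
      using in_strip_map[OF bspec[OF st]] by (intro bexI[of _ s]) simp_all
  qed
  have "\<exists>F. finite F \<and> (\<forall>y\<in>F. same_type M M0 a y) \<and>
    \<not> (\<exists>x. \<forall>y\<in>F. psat UNIV M \<phi> (asg n (map x [0..<n]) y))"
    by (rule no_fip_of_cover[OF fv _ _ st cov1]) (simp_all add: same_type_refl)
  then obtain F where F: "finite F" "\<forall>y\<in>F. same_type M M0 a y"
      "\<not> (\<exists>x. \<forall>y\<in>F. psat UNIV M \<phi> (asg n (map x [0..<n]) y))"
    by (elim exE conjE)
  have "\<not> (\<exists>x. length x = n \<and> (\<forall>y\<in>F. psat UNIV M \<phi> (asg n x y)))"
  proof (rule notI, elim exE conjE)
    fix x assume "length x = n" "\<forall>y\<in>F. psat UNIV M \<phi> (asg n x y)"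
    moreover from this(1) have "map (nth x) [0..<n] = x" using map_nth by blast
    ultimately show False using F(3) by metis
  qed
  then show ?thesis using F(1,2) unfolding fip_type_def by blast
qed

end

theorem theorem4p8:
  fixes M :: "'m pstruct" and M0 :: "'m set" and \<phi> :: pfm and n :: nat and a :: "'m list"
  assumes "models_Pres M"
    and "saturated M"
    and "elem_sub M0 M"
    and "(card_of M0, card_of (UNIV :: 'm set)) \<in> ordLess"
    and "fv \<phi> \<subseteq> {..<n + length a}"
    and "bounded_pres M n (defset M \<phi> n a)"
  shows "(\<not> forks M M0 n \<phi> a \<longleftrightarrow> fip_type M M0 n \<phi> a)
       \<and> (fip_type M M0 n \<phi> a \<longleftrightarrow> defset M \<phi> n a \<inter> {x. set x \<subseteq> M0} \<noteq> {})"
proof -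
  interpret pres_sub M M0
    using assms by unfold_locales
  show ?thesis
  \<comment> \<open>Both other conditions are settled by (3): without a point of \<open>M0\<close>,
    one cover by strips refutes both; with such a point, both hold.\<close>
  proof (cases "defset M \<phi> n a \<inter> {x. set x \<subseteq> M0} = {}")
    case True
    from bounded_cover[OF assms(6) True] obtain st where
      st: "\<forall>s\<in>set st. good_strip n s" "\<forall>x\<in>defset M \<phi> n a. \<exists>s\<in>set st. in_strip (nth x) s"
      by (elim exE conjE)
    show ?thesis
      using True forks_of_cover[OF st] cover_imp_not_fip[OF assms(5) st] by simp
  next
    case False
    then obtain x where "x \<in> defset M \<phi> n a" "set x \<subseteq> M0" by blast
    then show ?thesis
      using False points_imp_not_forks[OF assms(5)] points_imp_fip[OF assms(5)] by blast
  qed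
qed

end
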